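(* Let $(\mathbb{K},|\cdot|)$ be a complete normed field, $f\in\mathbb{K}[z]$ a polynomial of degree $n\ge 2$ and $1\le p\le\infty$. Let $a=(n-1)^{1/q}$, $b=2^{1/q}$ and define $$\gamma(t)=\frac{1}{1-at},\qquad \psi(t)=\frac{1-(a+b)t}{1-at},$$ $$\beta(t)=\frac{at^2}{(1-at)(1-(a+1)t)}\left(1+\frac{at}{(n-1)(1-(a+b)t)}\right)^{n-1},$$ $$\phi(t)=\frac{at^2}{(1-(a+1)t)(1-(a+b)t)}\left(1+\frac{at}{(n-1)(1-(a+b)t)}\right)^{n-1}.$$ Suppose $x^{(0)}\in\mathbb{K}^n$ is an initial guess with distinct components satisfying $$E_f(x^{(0)})<\frac{1}{a+b}\quad\text{and}\quad\phi(E_f(x^{(0)}))\le 1.$$ Then the following hold. (i) Starting from $x^{(0)}$, the Ehrlich iteration $x^{(k+1)}=\Phi(x^{(k)})$, $k=0,1,2,\ldots$, is well-defined, remains in the closed ball $\overline{U}(x^{(0)},\rho)$ and converges to a root vector $\xi$ of $f$, where $\rho=\frac{\gamma(E_f(x^{(0)}))}{1-\beta(E_f(x^{(0)}))}\,\|W_f(x^{(0)})\|$. Besides, the convergence is cubic provided that $\phi(E_f(x^{(0)}))<1$. (ii) For all $k\ge 0$, $$\|x^{(k)}-\xi\|\preceq A_k\,\frac{\theta^k\lambda^{(3^k-1)/2}}{1-\theta\lambda^{3^k}}\,\|W_f(x^{(0)})\|,$$ where $\lambda=\phi(E_f(x^{(0)}))$, $\theta=\psi(E_f(x^{(0)}))$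 and $A_k=\gamma\big(E_f(x^{(0)})\lambda^{(3^k-1)/2}\big)$. (iii) For all $k\ge 0$, $$\|x^{(k)}-\xi\|\preceq\frac{\gamma(E_f(x^{(k)}))}{1-\beta(E_f(x^{(k)}))}\,\|W_f(x^{(k)})\|.$$ (iv) For all $k\ge 0$, $$\|x^{(k+1)}-\xi\|\preceq\frac{\theta_k\lambda_k}{1-\theta_k(\lambda_k)^3}\,\gamma(E_f(x^{(k+1)}))\,\|W_f(x^{(k)})\|,$$ where $\lambda_k=\phi(E_f(x^{(k)}))$ and $\theta_k=\psi(E_f(x^{(k)}))$. (v) If $\phi(E_f(x^{(0)}))<1$, then $f$ has $n$ simple zeros in $\mathbb{K}$ and for every $k\ge 0$ the closed disks $D_i^k=\{z\in\mathbb{K}:|z-x_i^{(k)}|\le r_i^{(k)}\}$, $i=1,\ldots,n$, where $r_i^{(k)}=\frac{\gamma(E_f(x^{(k)}))}{1-\beta(E_f(x^{(k)}))}\,|W_i(x^{(k)})|$, are mutually disjoint and each of them contains exactly one zero of $f$.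
   Context: A complete normed field $(\mathbb{K},|\cdot|)$ is a field with an absolute value (multiplicative, satisfying the triangle inequality) which is complete as a metric space. $\mathbb{R}_+=[0,\infty)$, $I_n=\{1,\ldots,n\}$. For $1\le p\le\infty$, $\|x\|_p=(\sum_i|x_i|^p)^{1/p}$ (maximum norm if $p=\infty$); $q$ is the conjugate exponent, $1\le q\le\infty$, $1/p+1/q=1$ (with $1/\infty=0$). For $x\in\mathbb{K}^n$ the cone norm is $\|x\|=(|x_1|,\ldots,|x_n|)\in\mathbb{R}^n$; $\preceq$ is the coordinatewise order $\le$ on $\mathbb{R}^n$. For $x\in\mathbb{K}^n$ and $y\in\mathbb{R}^n$ with no zero components, $\frac{x}{y}=\big(\frac{|x_1|}{y_1},\ldots,\frac{|x_n|}{y_n}\big)$. Let $d(x)=(d_1(x),\ldots,d_n(x))$ with $d_i(x)=\min_{j\ne i}|x_i-x_j|$. $\mathcal{D}$ is the set of vectors in $\mathbb{K}^n$ with pairwise distinct components. If $C_0$ is the leading coefficient of $f$, the Weierstrass correction $W_f\colon\mathcal{D}\to\mathbb{K}^n$ is $W_f(x)=(W_1(x),\ldots,W_n(x))$ with $W_i(x)=\frac{f(x_i)}{C_0\prod_{j\ne i}(x_i-x_j)}$, and $E_f\colon\mathcal{D}\to\mathbb{R}_+$ is $E_f(x)=\big\|\frac{W_f(x)}{d(x)}\big\|_p$. Ehrlich's iteration function $\Phi=(\Phi_1,\ldots,\Phi_n)\colon D_\Phi\subset\mathbb{K}^n\to\mathbb{K}^n$ is $$\Phi_i(x)=x_i-\frac{f(x_i)}{f'(x_i)-f(x_i)\sum_{j\ne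 i}\frac{1}{x_i-x_j}}=x_i-\frac{W_i(x)}{1+\sum_{j\ne i}\frac{W_j(x)}{x_i-x_j}},$$ with domain $D_\Phi=\{x\in\mathcal{D}:1+\sum_{j\ne i}\frac{W_j(x)}{x_i-x_j}\ne 0\text{ for all }i\in I_n\}$ (the two expressions agree, and the two denominators vanish simultaneously). A vector $\xi\in\mathbb{K}^n$ is a root vector of $f$ if $f(z)=C_0\prod_{i=1}^n(z-\xi_i)$. For $\rho\in\mathbb{R}_+^n$, $\overline{U}(x^{(0)},\rho)=\{x\in\mathbb{K}^n:\|x-x^{(0)}\|\preceq\rho\}$. Convention: $0^0=1$. *)

theory Defs
  imports "HOL-Analysis.Analysis" "HOL-Computational_Algebra.Polynomial"
begin

text \<open>
  Fields that are complete with respect to an absolute value. No vector space structure over the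
  reals is required (unlike \<^class>\<open>real_normed_field\<close>), so non-Archimedean and trivial absolute values
  and arbitrary characteristic are included. The library constant \<^const>\<open>norm\<close> is not used because it
  is restricted to real vector spaces. Definiteness and the triangle inequality of the absolute
  value come from the metric, see the lemmas below.
\<close>

class complete_normed_field = field + complete_space +
  fixes abs_val :: "'a \<Rightarrow> real"
  assumes dist_abs_val: "dist x y = abs_val (x - y)"
    and abs_val_mult: "abs_val (x * y) = abs_val x * abs_val y"
begin

lemma abs_val_eq_0_iff: "abs_val x = 0 \<longleftrightarrow> x = 0"
  by (metis diff_zero dist_eq_0_iff dist_abs_val)

lemma abs_val_nonneg: "0 \<le> abs_val x"
  by (metis diff_zero dist_abs_val zero_le_dist)

lemma abs_val_minus: "abs_val (- x) = abs_val x"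
  by (metis diff_0 diff_zero dist_commute dist_abs_val)

lemma abs_val_triangle: "abs_val (x + y) \<le> abs_val x + abs_val y"
proof -
  have "abs_val (x + y) = dist x (- y)" by (simp add: dist_abs_val)
  also have "\<dots> \<le> dist x 0 + dist (- y) 0" by (rule dist_triangle2)
  also have "\<dots> = abs_val x + abs_val y" by (simp add: dist_abs_val abs_val_minus)
  finally show ?thesis .
qed

end

instantiation complex :: complete_normed_field
begin

definition abs_val_complex :: "complex \<Rightarrow> real" where "abs_val_complex = norm"

instance by standard (simp_all add: abs_val_complex_def dist_norm norm_mult)

end

text \<open>
  Vectors with \<open>n\<close> components are elements of \<open>'a ^ 'n\<close> with \<open>CARD('n) = n\<close>. The order on
  \<open>real ^ 'n\<close> is the library's coordinatewise order, convergence in \<open>'a ^ 'n\<close> is coordinatewise.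
\<close>

definition p_norm :: "ereal \<Rightarrow> real ^ 'n \<Rightarrow> real" where
  "p_norm p v =
    (if p = \<infinity> then Max (range (\<lambda>i. \<bar>v $ i\<bar>))
     else (\<Sum>i\<in>UNIV. \<bar>v $ i\<bar> powr real_of_ereal p) powr (1 / real_of_ereal p))"

definition cone_norm :: "'a::complete_normed_field ^ 'n \<Rightarrow> real ^ 'n" where
  "cone_norm x = (\<chi> i. abs_val (x $ i))"

definition vec_quot :: "'a::complete_normed_field ^ 'n \<Rightarrow> real ^ 'n \<Rightarrow> real ^ 'n" where
  "vec_quot x y = (\<chi> i. abs_val (x $ i) / y $ i)"

definition cone_cball :: "'a::complete_normed_field ^ 'n \<Rightarrow> real ^ 'n \<Rightarrow> ('a ^ 'n) set" where
  "cone_cball c \<rho> = {x. cone_norm (x - c) \<le> \<rho>}"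

text \<open>Only meaningful for \<open>CARD('n) \<ge> 2\<close> (otherwise the minimum is over the empty set).\<close>

definition separation :: "'a::complete_normed_field ^ 'n \<Rightarrow> real ^ 'n" where
  "separation x = (\<chi> i. Min ((\<lambda>j. abs_val (x $ i - x $ j)) ` (UNIV - {i})))"

definition distinct_vecs :: "('a ^ 'n) set" where
  "distinct_vecs = {x. inj (\<lambda>i. x $ i)}"

definition weierstrass :: "'a::field poly \<Rightarrow> 'a ^ 'n \<Rightarrow> 'a ^ 'n" where
  "weierstrass f x =
    (\<chi> i. poly f (x $ i) / (lead_coeff f * (\<Prod>j\<in>UNIV - {i}. x $ i - x $ j)))"

definition E_fun :: "ereal \<Rightarrow> 'a::complete_normed_field poly \<Rightarrow> 'a ^ 'n \<Rightarrow> real" where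
  "E_fun p f x = p_norm p (vec_quot (weierstrass f x) (separation x))"

text \<open>
  The partial map of Ehrlich is given by a total function together with its domain; outside the
  domain the values of \<open>ehrlich\<close> are meaningless.
\<close>

definition ehrlich :: "'a::field poly \<Rightarrow> 'a ^ 'n \<Rightarrow> 'a ^ 'n" where
  "ehrlich f x =
    (\<chi> i. x $ i - poly f (x $ i) /
       (poly (pderiv f) (x $ i) - poly f (x $ i) * (\<Sum>j\<in>UNIV - {i}. 1 / (x $ i - x $ j))))"

definition ehrlich_domain :: "'a::field poly \<Rightarrow> ('a ^ 'n) set" where
  "ehrlich_domain f =
    {x \<in> distinct_vecs.
       \<forall>i. 1 + (\<Sum>j\<in>UNIV - {i}. weierstrass f x $ j / (x $ i - x $ j)) \<noteq> 0}"

text \<open>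
  An identity of polynomials, not merely of polynomial functions; the two differ over finite fields.
\<close>

definition root_vector :: "'a::field poly \<Rightarrow> 'a ^ 'n \<Rightarrow> bool" where
  "root_vector f \<xi> \<longleftrightarrow> f = smult (lead_coeff f) (\<Prod>i\<in>UNIV. [:- (\<xi> $ i), 1:])"

text \<open>
  Convergence of Q-order at least \<open>r\<close>. On \<open>'a ^ 'n\<close> the choice of the distance only affects \<open>C\<close>.
\<close>

definition converges_with_order :: "nat \<Rightarrow> (nat \<Rightarrow> 'b::metric_space) \<Rightarrow> 'b \<Rightarrow> bool" where
  "converges_with_order r x l \<longleftrightarrow>
    x \<longlonglongrightarrow> l \<and>
    (\<exists>C. \<forall>\<^sub>F k in sequentially. dist (x (Suc k)) l \<le> C * dist (x k) l ^ r)"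

text \<open>
  The real functions of the theorem for degree \<open>n\<close> and conjugate exponent \<open>q\<close>; in \<^typ>\<open>ereal\<close> we have
  \<open>1 / \<infinity> = 0\<close>.
\<close>

definition coeff_a :: "nat \<Rightarrow> ereal \<Rightarrow> real" where
  "coeff_a n q = (real n - 1) powr real_of_ereal (1 / q)"

definition coeff_b :: "ereal \<Rightarrow> real" where
  "coeff_b q = 2 powr real_of_ereal (1 / q)"

definition gamma_fun :: "nat \<Rightarrow> ereal \<Rightarrow> real \<Rightarrow> real" where
  "gamma_fun n q t = 1 / (1 - coeff_a n q * t)"

definition psi_fun :: "nat \<Rightarrow> ereal \<Rightarrow> real \<Rightarrow> real" where
  "psi_fun n q t = (1 - (coeff_a n q + coeff_b q) * t) / (1 - coeff_a n q * t)"

definition beta_fun :: "nat \<Rightarrow> ereal \<Rightarrow> real \<Rightarrow> real" where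
  "beta_fun n q t =
    (let a = coeff_a n q; b = coeff_b q in
     a * t ^ 2 / ((1 - a * t) * (1 - (a + 1) * t)) *
     (1 + a * t / ((real n - 1) * (1 - (a + b) * t))) ^ (n - 1))"

definition phi_fun :: "nat \<Rightarrow> ereal \<Rightarrow> real \<Rightarrow> real" where
  "phi_fun n q t =
    (let a = coeff_a n q; b = coeff_b q in
     a * t ^ 2 / ((1 - (a + 1) * t) * (1 - (a + b) * t)) *
     (1 + a * t / ((real n - 1) * (1 - (a + b) * t))) ^ (n - 1))"

definition ehrlich_iter :: "'a::field poly \<Rightarrow> 'a ^ 'n \<Rightarrow> nat \<Rightarrow> 'a ^ 'n" where
  "ehrlich_iter f x0 k = (ehrlich f ^^ k) x0"

end

theory Submission
  imports Defs
begin

text \<open>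
  Put \<open>y = \<Phi>(x)\<close>. Lagrange interpolation of \<open>f\<close> at the components of \<open>x\<close> expresses \<open>f(y\<^sub>i)\<close> through
  the \<open>W\<^sub>j(x)\<close>; since \<open>y\<^sub>i\<close> is one Ehrlich step away from \<open>x\<^sub>i\<close>, the terms of first order in the
  displacement cancel and \<open>W\<^sub>i(y)\<close> carries the factor \<open>(y\<^sub>i - x\<^sub>i)\<^sup>2\<close>. The Hoelder inequality and the inequality of
  the means turn this into \<open>\<bar>W\<^sub>i(y)\<bar> \<le> \<beta>(E) \<bar>W\<^sub>i(x)\<bar>\<close>, while \<open>d\<^sub>i(y) \<ge> \<psi>(E) d\<^sub>i(x)\<close>, so that
  \<open>E(y) \<le> \<phi>(E) E\<close> with \<open>\<phi> = \<beta> / \<psi>\<close>. As \<open>\<phi>(s t) \<le> s\<^sup>2 \<phi>(t)\<close> for \<open>0 \<le> s \<le> 1\<close>,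
  it follows that \<open>\<phi>(E(y)) \<le> \<phi>(E)\<^sup>3\<close>. The displacements \<open>\<gamma>(E) \<bar>W\<^sub>i\<bar>\<close> are then dominated by a geometric series,
  whose tail bounds the distance to the limit. The limit is a root vector because the coefficients of the
  interpolation formula for \<open>f\<close> converge and the Weierstrass corrections tend to \<open>0\<close>.
\<close>

section \<open>Absolute values and \<open>p\<close>-norms\<close>

lemma abs_val_0 [simp]: "abs_val (0 :: 'a::complete_normed_field) = 0"
  by (simp add: abs_val_eq_0_iff)

lemma abs_val_1 [simp]: "abs_val (1 :: 'a::complete_normed_field) = 1"
  using abs_val_mult[of 1 "1::'a"] by (simp add: abs_val_eq_0_iff)

lemma abs_val_pos_iff: "0 < abs_val (x :: 'a::complete_normed_field) \<longleftrightarrow> x \<noteq> 0"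
  using abs_val_nonneg[of x] by (auto simp: less_le abs_val_eq_0_iff)

lemma abs_val_divide: "abs_val (x / y :: 'a::complete_normed_field) = abs_val x / abs_val y"
proof (cases "y = 0")
  case False
  then have "abs_val (x / y) * abs_val y = abs_val x"
    by (simp flip: abs_val_mult)
  then show ?thesis using False by (simp add: field_simps abs_val_eq_0_iff)
qed simp

lemma abs_val_prod: "abs_val (prod f S :: 'a::complete_normed_field) = (\<Prod>i\<in>S. abs_val (f i))"
  by (induction S rule: infinite_finite_induct) (simp_all add: abs_val_mult)

lemma abs_val_sum_le: "abs_val (sum f S :: 'a::complete_normed_field) \<le> (\<Sum>i\<in>S. abs_val (f i))"
  by (induction S rule: infinite_finite_induct)
    (auto intro: order_trans[OF abs_val_triangle])

lemma abs_val_minus_commute: "abs_val (x - y :: 'a::complete_normed_field) = abs_val (y - x)"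
  by (metis abs_val_minus minus_diff_eq)

lemma abs_val_diff_ge: "abs_val (x :: 'a::complete_normed_field) - abs_val y \<le> abs_val (x - y)"
  using abs_val_triangle[of "x - y" y] by simp

section \<open>Limits in the field and of polynomial coefficients\<close>

lemma tendsto_abs_val_iff:
  "(u \<longlongrightarrow> (l :: 'a::complete_normed_field)) F \<longleftrightarrow> ((\<lambda>k. abs_val (u k - l)) \<longlongrightarrow> 0) F"
  by (subst tendsto_dist_iff) (simp add: dist_abs_val)

lemma tendsto_abs_val:
  assumes "(u \<longlongrightarrow> (l :: 'a::complete_normed_field)) F"
  shows "((\<lambda>k. abs_val (u k)) \<longlongrightarrow> abs_val l) F"
  using tendsto_dist[OF assms tendsto_const[of 0]] by (simp add: dist_abs_val)

lemma tendsto_field_add: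
  assumes "(u \<longlongrightarrow> (l :: 'a::complete_normed_field)) F" "(v \<longlongrightarrow> m) F"
  shows "((\<lambda>k. u k + v k) \<longlongrightarrow> l + m) F"
  unfolding tendsto_abs_val_iff
proof (rule tendsto_sandwich[OF _ _ tendsto_const])
  show "\<forall>\<^sub>F k in F. abs_val (u k + v k - (l + m)) \<le> abs_val (u k - l) + abs_val (v k - m)"
    by (simp add: add_diff_add abs_val_triangle)
  show "((\<lambda>k. abs_val (u k - l) + abs_val (v k - m)) \<longlongrightarrow> 0) F"
    using assms unfolding tendsto_abs_val_iff by (rule tendsto_add_zero)
qed (simp add: abs_val_nonneg)

lemma tendsto_field_mult:
  assumes "(u \<longlongrightarrow> (l :: 'a::complete_normed_field)) F" "(v \<longlongrightarrow> m) F"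
  shows "((\<lambda>k. u k * v k) \<longlongrightarrow> l * m) F"
  unfolding tendsto_abs_val_iff
proof (rule tendsto_sandwich[OF _ _ tendsto_const])
  have "abs_val (u k * v k - l * m) \<le> abs_val (u k) * abs_val (v k - m) + abs_val (u k - l) * abs_val m"
    for k
    using abs_val_triangle[of "u k * (v k - m)" "(u k - l) * m"]
    by (simp add: algebra_simps flip: abs_val_mult)
  then show "\<forall>\<^sub>F k in F. abs_val (u k * v k - l * m)
      \<le> abs_val (u k) * abs_val (v k - m) + abs_val (u k - l) * abs_val m"
    by simp
  have "((\<lambda>k. abs_val (u k) * abs_val (v k - m) + abs_val (u k - l) * abs_val m)
      \<longlongrightarrow> abs_val l * 0 + 0 * abs_val m) F"
    using assms by (intro tendsto_intros tendsto_abs_val) (simp_all add: tendsto_abs_val_iff)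
  then show "((\<lambda>k. abs_val (u k) * abs_val (v k - m) + abs_val (u k - l) * abs_val m) \<longlongrightarrow> 0) F"
    by simp
qed (simp add: abs_val_nonneg)

lemma tendsto_field_sum:
  assumes "\<And>i. i \<in> S \<Longrightarrow> (u i \<longlongrightarrow> (l i :: 'a::complete_normed_field)) F"
  shows "((\<lambda>k. \<Sum>i\<in>S. u i k) \<longlongrightarrow> (\<Sum>i\<in>S. l i)) F"
  using assms by (induction S rule: infinite_finite_induct) (auto intro: tendsto_field_add)

text \<open>A coefficient of a product is a finite sum of products of coefficients. Limits of
  polynomials are taken coefficientwise because \<open>root_vector\<close> is an identity of
  polynomials and not of their values.\<close>

lemma tendsto_coeff_mult:
  fixes P Q :: "'b \<Rightarrow> 'a::complete_normed_field poly"
  assumes "\<And>m. ((\<lambda>k. coeff (P k) m) \<longlongrightarrow> coeff P' m) F" "\<And>m. ((\<lambda>k. coeff (Q k) m) \<longlongrightarrow> coeff Q' m) F"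
  shows "((\<lambda>k. coeff (P k * Q k) m) \<longlongrightarrow> coeff (P' * Q') m) F"
  unfolding coeff_mult by (intro tendsto_field_sum tendsto_field_mult assms)

lemma tendsto_coeff_prod:
  fixes P :: "'c \<Rightarrow> 'b \<Rightarrow> 'a::complete_normed_field poly"
  assumes "\<And>i m. i \<in> S \<Longrightarrow> ((\<lambda>k. coeff (P i k) m) \<longlongrightarrow> coeff (L i) m) F"
  shows "((\<lambda>k. coeff (\<Prod>i\<in>S. P i k) m) \<longlongrightarrow> coeff (\<Prod>i\<in>S. L i) m) F"
  using assms
proof (induction S arbitrary: m rule: infinite_finite_induct)
  case (insert i S)
  then show ?case by (simp add: tendsto_coeff_mult)
qed simp_all

text \<open>The inequality of arithmetic and geometric means for the factors \<open>1 + u i\<close>.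
  With \<open>n - 1\<close> factors it produces the power that occurs in \<open>beta_fun\<close> and
  \<open>phi_fun\<close>.\<close>

lemma prod_one_plus_le_mean_power:
  fixes u :: "'b \<Rightarrow> real"
  assumes "finite S" "\<And>i. i \<in> S \<Longrightarrow> 0 \<le> u i"
  shows "(\<Prod>i\<in>S. 1 + u i) \<le> (1 + (\<Sum>i\<in>S. u i) / card S) ^ card S"
proof (cases "S = {}")
  case False
  define m where "m = real (card S)"
  have m: "m > 0" using False assms(1) by (simp add: m_def card_gt_0_iff)
  have P: "0 \<le> (\<Prod>i\<in>S. 1 + u i)" using assms(2) by (intro prod_nonneg) force
  have "(\<Prod>i\<in>S. 1 + u i) powr (1 / m) \<le> (\<Sum>i\<in>S. (1 + u i) / m)"
    unfolding m_def using assms False by (intro arith_geom_mean) force+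
  also have "\<dots> = 1 + (\<Sum>i\<in>S. u i) / m"
    using m by (simp add: m_def sum.distrib add_divide_distrib flip: sum_divide_distrib)
  finally have "((\<Prod>i\<in>S. 1 + u i) powr (1 / m)) ^ card S \<le> (1 + (\<Sum>i\<in>S. u i) / m) ^ card S"
    by (intro power_mono) auto
  moreover have "((\<Prod>i\<in>S. 1 + u i) powr (1 / m)) ^ card S = (\<Prod>i\<in>S. 1 + u i)"
    using P m False assms(1) by (simp add: powr_powr m_def flip: powr_realpow')
  ultimately show ?thesis by (simp add: m_def)
qed simp

text \<open>Hoelder's inequality against a constant vector, obtained from Jensen's inequality for
  the convex function \<open>\<lambda>t. t powr r\<close> with equal weights.\<close>

lemma powr_mean_le:
  fixes u :: "'b \<Rightarrow> real"
  assumes r: "1 \<le> r" and S: "finite S" and u: "\<And>i. i \<in> S \<Longrightarrow> 0 \<le> u i"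
  shows "(\<Sum>i\<in>S. u i) \<le> real (card S) powr (1 - 1 / r) * (\<Sum>i\<in>S. u i powr r) powr (1 / r)"
proof -
  \<comment> \<open>Jensen's inequality is applied to the positive entries only. The zero entries
    contribute to neither sum.\<close>
  define T where "T = {i \<in> S. u i > 0}"
  have T: "finite T" "T \<subseteq> S" using S by (auto simp: T_def)
  have zero: "u i = 0" if "i \<in> S - T" for i using that u[of i] by (auto simp: T_def)
  have sums: "(\<Sum>i\<in>S. u i) = (\<Sum>i\<in>T. u i)" "(\<Sum>i\<in>S. u i powr r) = (\<Sum>i\<in>T. u i powr r)"
    using S T zero by (auto intro!: sum.mono_neutral_right)
  show ?thesis
  proof (cases "T = {}")
    case True
    then show ?thesis by (simp add: sums)
  next
    case False
    define c where "c = real (card T)"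
    have c: "0 < c" using T False by (simp add: c_def card_gt_0_iff)
    have "(\<Sum>i\<in>T. (1 / c) *\<^sub>R u i) powr r \<le> (\<Sum>i\<in>T. (1 / c) * (u i) powr r)"
      using c False T by (intro convex_on_sum[OF _ _ powr_convex[OF r]]) (auto simp: c_def T_def)
    then have "(\<Sum>i\<in>T. u i) powr r / c powr r \<le> (\<Sum>i\<in>T. u i powr r) / c"
      using c by (simp add: powr_divide sum_nonneg T_def less_imp_le flip: sum_divide_distrib)
    then have "(\<Sum>i\<in>T. u i) powr r \<le> c powr (r - 1) * (\<Sum>i\<in>T. u i powr r)"
      using c by (simp add: powr_diff field_simps)
    then have "((\<Sum>i\<in>T. u i) powr r) powr (1 / r) \<le> (c powr (r - 1) * (\<Sum>i\<in>T. u i powr r)) powr (1 / r)"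
      using r by (intro powr_mono2) auto
    moreover have "((\<Sum>i\<in>T. u i) powr r) powr (1 / r) = (\<Sum>i\<in>T. u i)"
      using r u T by (simp add: powr_powr abs_of_nonneg sum_nonneg subsetD)
    moreover have "(c powr (r - 1) * (\<Sum>i\<in>T. u i powr r)) powr (1 / r)
        = c powr (1 - 1 / r) * (\<Sum>i\<in>T. u i powr r) powr (1 / r)"
      using r by (simp add: powr_mult sum_nonneg powr_powr diff_divide_distrib)
    ultimately have "(\<Sum>i\<in>T. u i) \<le> c powr (1 - 1 / r) * (\<Sum>i\<in>T. u i powr r) powr (1 / r)"
      by simp
    \<comment> \<open>The exponent \<open>1 - 1 / r\<close> is nonnegative, so replacing
      \<open>card T\<close> by the larger \<open>card S\<close> keeps the bound.\<close>
    also have "\<dots> \<le> real (card S) powr (1 - 1 / r) * (\<Sum>i\<in>T. u i powr r) powr (1 / r)"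
      using r c T S by (intro mult_right_mono powr_mono2) (auto simp: c_def card_mono)
    finally show ?thesis by (simp add: sums)
  qed
qed

text \<open>Only \<open>1 / q\<close> enters the constants, so \<open>q = \<infinity>\<close> needs
  no case of its own: it is \<open>r = 1\<close> in the second case, with exponent 0.\<close>

lemma conjugate_exponent_cases:
  assumes "1 \<le> p" "1 \<le> q" "1 / p + 1 / q = (1 :: ereal)"
  obtains "p = \<infinity>" "real_of_ereal (1 / q) = 1"
    | r where "p = ereal r" "1 \<le> r" "real_of_ereal (1 / q) = 1 - 1 / r"
proof (cases p)
  case PInf
  then show ?thesis using that assms by (simp add: zero_ereal_def one_ereal_def)
next
  case (real r)
  then have r: "1 \<le> r" using assms by simp
  then have *: "1 / p = ereal (1 / r)" using real by (simp add: one_ereal_def)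
  have "1 / q = ereal (1 - 1 / r)" using assms(3) unfolding *
    by (cases "1 / q") (auto simp: one_ereal_def)
  then show ?thesis using that real r by simp
qed (use assms in simp)

lemma p_norm_nonneg: "0 \<le> p_norm p v"
  unfolding p_norm_def by (auto intro!: Max_ge_iff[THEN iffD2])

text \<open>Hoelder's inequality against the indicator of \<open>S\<close>. Index sets with
  \<open>n - 1\<close>, 2 and 1 elements give the constants \<open>a\<close>, \<open>b\<close> and 1
  of the theorem.\<close>

lemma sum_le_p_norm:
  fixes v :: "real ^ 'n"
  assumes "1 \<le> p" "1 \<le> q" "1 / p + 1 / q = (1 :: ereal)"
  shows "(\<Sum>i\<in>S. \<bar>v $ i\<bar>) \<le> real (card S) powr real_of_ereal (1 / q) * p_norm p v"
  using assms
proof (cases rule: conjugate_exponent_cases)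
  case 1
  have "(\<Sum>i\<in>S. \<bar>v $ i\<bar>) \<le> real (card S) * Max (range (\<lambda>i. \<bar>v $ i\<bar>))"
    using sum_bounded_above[of S "\<lambda>i. \<bar>v $ i\<bar>" "Max (range (\<lambda>i. \<bar>v $ i\<bar>))"] by simp
  then show ?thesis using 1 by (simp add: p_norm_def)
next
  case (2 r)
  have "(\<Sum>i\<in>S. \<bar>v $ i\<bar>) \<le> real (card S) powr (1 - 1 / r) * (\<Sum>i\<in>S. \<bar>v $ i\<bar> powr r) powr (1 / r)"
    using 2 by (intro powr_mean_le) auto
  also have "\<dots> \<le> real (card S) powr (1 - 1 / r) * (\<Sum>i\<in>UNIV. \<bar>v $ i\<bar> powr r) powr (1 / r)"
    using 2 by (intro mult_left_mono powr_mono2 sum_mono2 sum_nonneg) auto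
  finally show ?thesis using 2 by (simp add: p_norm_def)
qed

text \<open>Monotonicity and homogeneity in one statement, so that a componentwise contraction
  factor passes directly to \<open>E_fun\<close>.\<close>

lemma p_norm_mono_scale:
  fixes u v :: "real ^ 'n"
  assumes "1 \<le> p" "0 \<le> c" "\<And>i. \<bar>u $ i\<bar> \<le> c * \<bar>v $ i\<bar>"
  shows "p_norm p u \<le> c * p_norm p v"
proof (cases "p = \<infinity>")
  case True
  have "\<bar>u $ i\<bar> \<le> c * Max (range (\<lambda>i. \<bar>v $ i\<bar>))" for i
    using assms(3)[of i] by (rule order_trans) (use assms in \<open>intro mult_left_mono, auto\<close>)
  then show ?thesis using True by (simp add: p_norm_def)
next
  case False
  then obtain r where r: "p = ereal r" "1 \<le> r" using assms(1) by (cases p) auto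
  have "(\<Sum>i\<in>UNIV. \<bar>u $ i\<bar> powr r) powr (1 / r) \<le> (\<Sum>i\<in>UNIV. (c * \<bar>v $ i\<bar>) powr r) powr (1 / r)"
    using assms r by (intro powr_mono2 sum_mono sum_nonneg) auto
  also have "(\<Sum>i\<in>UNIV. (c * \<bar>v $ i\<bar>) powr r) = c powr r * (\<Sum>i\<in>UNIV. \<bar>v $ i\<bar> powr r)"
    using assms by (simp add: powr_mult sum_distrib_left)
  also have "(c powr r * (\<Sum>i\<in>UNIV. \<bar>v $ i\<bar> powr r)) powr (1 / r) = c * (\<Sum>i\<in>UNIV. \<bar>v $ i\<bar> powr r) powr (1 / r)"
    using assms r by (simp add: powr_mult powr_powr sum_nonneg)
  finally show ?thesis using r by (simp add: p_norm_def)
qed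

lemma p_norm_le_bound:
  fixes v :: "real ^ 'n"
  assumes "1 \<le> p" and bound: "\<And>i. \<bar>v $ i\<bar> \<le> c"
  shows "p_norm p v \<le> p_norm p (\<chi> i::'n. 1) * c"
proof -
  have "0 \<le> c" using bound[of undefined] by linarith
  then show ?thesis using p_norm_mono_scale[OF assms(1), of c v "\<chi> i. 1"] bound
    by (simp add: mult.commute)
qed

section \<open>The majorant functions\<close>

locale degree_exponent =
  fixes n :: nat and q :: ereal
  assumes n_ge_2: "2 \<le> n" and q_ge_1: "1 \<le> q"
begin

abbreviation "a \<equiv> coeff_a n q"
abbreviation "b \<equiv> coeff_b q"
abbreviation "\<gamma> \<equiv> gamma_fun n q"
abbreviation "\<psi> \<equiv> psi_fun n q"
abbreviation "\<beta> \<equiv> beta_fun n q"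
abbreviation "\<phi> \<equiv> phi_fun n q"

lemma inverse_exponent_nonneg: "0 \<le> real_of_ereal (1 / q)"
  using q_ge_1 by (intro real_of_ereal_pos) (cases q; simp)

lemma a_ge_1: "1 \<le> a" and b_ge_1: "1 \<le> b"
  using inverse_exponent_nonneg n_ge_2 unfolding coeff_a_def coeff_b_def
  by (auto intro!: ge_one_powr_ge_zero)

text \<open>The range on which all denominators of the majorants are positive, written without a
  quotient.\<close>

definition valid :: "real \<Rightarrow> bool" where
  "valid t \<longleftrightarrow> 0 \<le> t \<and> (a + b) * t < 1"

lemma valid_iff: "valid t \<longleftrightarrow> 0 \<le> t \<and> t < 1 / (a + b)"
  using a_ge_1 b_ge_1 by (auto simp: valid_def field_simps)

lemma valid_mono: "valid t \<Longrightarrow> 0 \<le> s \<Longrightarrow> s \<le> t \<Longrightarrow> valid s"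
  unfolding valid_iff by auto

lemma denominators_pos:
  assumes "valid t"
  shows "0 < 1 - a * t" "0 < 1 - (a + 1) * t" "0 < 1 - (a + b) * t"
proof -
  have "a * t \<le> (a + b) * t" "(a + 1) * t \<le> (a + b) * t"
    using assms b_ge_1 by (auto simp: valid_def intro!: mult_right_mono)
  then show "0 < 1 - a * t" "0 < 1 - (a + 1) * t" "0 < 1 - (a + b) * t"
    using assms by (auto simp: valid_def)
qed

lemma power_factor_mono:
  assumes "valid t" "0 \<le> s" "s \<le> t"
  shows "1 \<le> 1 + a * s / ((real n - 1) * (1 - (a + b) * s))"
    and "1 + a * s / ((real n - 1) * (1 - (a + b) * s)) \<le> 1 + a * t / ((real n - 1) * (1 - (a + b) * t))"
proof -
  have n: "0 < real n - 1" using n_ge_2 by simp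
  note pos = denominators_pos[OF assms(1)] denominators_pos[OF valid_mono[OF assms]]
  show "1 \<le> 1 + a * s / ((real n - 1) * (1 - (a + b) * s))"
    using n pos a_ge_1 assms by simp
  have "(a + b) * s \<le> (a + b) * t" using assms a_ge_1 b_ge_1 by (intro mult_left_mono) auto
  then have "a * s / ((real n - 1) * (1 - (a + b) * s)) \<le> a * t / ((real n - 1) * (1 - (a + b) * t))"
    using n pos a_ge_1 assms by (intro frac_le mult_left_mono mult_nonneg_nonneg mult_pos_pos) auto
  then show "1 + a * s / ((real n - 1) * (1 - (a + b) * s)) \<le> 1 + a * t / ((real n - 1) * (1 - (a + b) * t))"
    by simp
qed

text \<open>The corrections shrink by \<open>\<beta>\<close> and the separations by at most
  \<open>\<psi>\<close>, so the quotients of both shrink by \<open>\<phi>\<close>.\<close>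

lemma beta_eq: "valid t \<Longrightarrow> \<beta> t = \<psi> t * \<phi> t"
  using denominators_pos[of t] by (simp add: beta_fun_def psi_fun_def phi_fun_def Let_def)

lemma gamma_ge_1: "valid t \<Longrightarrow> 1 \<le> \<gamma> t"
  using denominators_pos[of t] a_ge_1 by (simp add: gamma_fun_def valid_def)

lemma gamma_mono:
  assumes "valid t" "0 \<le> s" "s \<le> t"
  shows "\<gamma> s \<le> \<gamma> t"
proof -
  have "a * s \<le> a * t" using assms a_ge_1 by (intro mult_left_mono) auto
  then show ?thesis unfolding gamma_fun_def
    using denominators_pos[OF assms(1)] by (intro divide_left_mono mult_pos_pos) auto
qed

lemma psi_pos: "valid t \<Longrightarrow> 0 < \<psi> t"
  using denominators_pos[of t] by (simp add: psi_fun_def)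

text \<open>The right side is the relative amount by which two nodes can approach each other in one
  step: each moves by at most \<open>\<gamma>\<close> times its correction, and the two quotients
  together are at most \<open>b * t\<close>.\<close>

lemma one_minus_psi: "valid t \<Longrightarrow> 1 - \<psi> t = \<gamma> t * b * t"
  using denominators_pos[of t] by (simp add: psi_fun_def gamma_fun_def field_simps)

lemma psi_less_1:
  assumes "valid t" "0 < t"
  shows "\<psi> t < 1"
proof -
  have "0 < \<gamma> t * b * t" using gamma_ge_1[of t] b_ge_1 assms by simp
  then show ?thesis using one_minus_psi[of t] assms by simp
qed

lemma psi_le_1: "valid t \<Longrightarrow> \<psi> t \<le> 1"
  using psi_less_1[of t] by (cases "t = 0") (auto simp: valid_def psi_fun_def)

lemma phi_nonneg: "valid t \<Longrightarrow> 0 \<le> \<phi> t"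
  using denominators_pos[of t] a_ge_1 power_factor_mono(1)[of t t]
  by (auto simp: phi_fun_def Let_def valid_def intro!: mult_nonneg_nonneg divide_nonneg_pos)

lemma phi_0 [simp]: "\<phi> 0 = 0"
  by (simp add: phi_fun_def Let_def)

text \<open>The factor \<open>t\<^sup>2\<close> scales by exactly \<open>l\<^sup>2\<close>, and the
  remaining factors are nondecreasing on the valid range. This quadratic gain is the source of the
  third order.\<close>

lemma phi_scale:
  assumes t: "valid t" and l: "0 \<le> l" "l \<le> 1"
  shows "\<phi> (l * t) \<le> l\<^sup>2 * \<phi> t"
proof -
  have t0: "0 \<le> t" using t by (simp add: valid_def)
  define s where "s = l * t"
  have s: "0 \<le> s" "s \<le> t" using l t0 by (simp_all add: s_def mult_left_le_one_le)
  note pos = denominators_pos[OF t] denominators_pos[OF valid_mono[OF t s]]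
  have "a * s\<^sup>2 / ((1 - (a + 1) * s) * (1 - (a + b) * s)) \<le> a * s\<^sup>2 / ((1 - (a + 1) * t) * (1 - (a + b) * t))"
    using pos s a_ge_1 b_ge_1 by (intro divide_left_mono mult_mono mult_pos_pos diff_left_mono) auto
  then have "\<phi> s \<le> a * s\<^sup>2 / ((1 - (a + 1) * t) * (1 - (a + b) * t)) *
     (1 + a * t / ((real n - 1) * (1 - (a + b) * t))) ^ (n - 1)"
    unfolding phi_fun_def Let_def using power_factor_mono[OF t s] pos a_ge_1
    by (intro mult_mono power_mono) auto
  also have "\<dots> = l\<^sup>2 * \<phi> t" by (simp add: phi_fun_def Let_def s_def power_mult_distrib)
  finally show ?thesis by (simp add: s_def)
qed

lemma beta_scale:
  assumes t: "valid t" and l: "0 \<le> l" "l \<le> 1"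
  shows "\<beta> (l * t) \<le> l\<^sup>2 * \<beta> t"
proof -
  have t0: "0 \<le> t" using t by (simp add: valid_def)
  define s where "s = l * t"
  have s: "0 \<le> s" "s \<le> t" using l t0 by (simp_all add: s_def mult_left_le_one_le)
  note pos = denominators_pos[OF t] denominators_pos[OF valid_mono[OF t s]]
  have "a * s\<^sup>2 / ((1 - a * s) * (1 - (a + 1) * s)) \<le> a * s\<^sup>2 / ((1 - a * t) * (1 - (a + 1) * t))"
    using pos s a_ge_1 b_ge_1 by (intro divide_left_mono mult_mono mult_pos_pos diff_left_mono) auto
  then have "\<beta> s \<le> a * s\<^sup>2 / ((1 - a * t) * (1 - (a + 1) * t)) *
     (1 + a * t / ((real n - 1) * (1 - (a + b) * t))) ^ (n - 1)"
    unfolding beta_fun_def Let_def using power_factor_mono[OF t s] pos a_ge_1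
    by (intro mult_mono power_mono) auto
  also have "\<dots> = l\<^sup>2 * \<beta> t" by (simp add: beta_fun_def Let_def s_def power_mult_distrib)
  finally show ?thesis by (simp add: s_def)
qed

lemma phi_mono: "valid t \<Longrightarrow> 0 \<le> s \<Longrightarrow> s \<le> t \<Longrightarrow> \<phi> s \<le> \<phi> t"
proof (cases "t = 0")
  case False
  assume *: "valid t" "0 \<le> s" "s \<le> t"
  then have "\<phi> s \<le> (s / t)\<^sup>2 * \<phi> t" using phi_scale[of t "s / t"] False by simp
  also have "\<dots> \<le> 1 * \<phi> t" using * False phi_nonneg
    by (intro mult_right_mono) (auto intro!: power_le_one)
  finally show ?thesis by simp
qed simp

lemma beta_nonneg: "valid t \<Longrightarrow> 0 \<le> \<beta> t"
  by (simp add: beta_eq phi_nonneg psi_pos less_imp_le)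

lemma beta_mono: "valid t \<Longrightarrow> 0 \<le> s \<Longrightarrow> s \<le> t \<Longrightarrow> \<beta> s \<le> \<beta> t"
proof (cases "t = 0")
  case False
  assume *: "valid t" "0 \<le> s" "s \<le> t"
  then have "\<beta> s \<le> (s / t)\<^sup>2 * \<beta> t" using beta_scale[of t "s / t"] False by simp
  also have "\<dots> \<le> 1 * \<beta> t" using * False beta_nonneg
    by (intro mult_right_mono) (auto intro!: power_le_one)
  finally show ?thesis by simp
qed simp

text \<open>Strictness survives the boundary case \<open>\<phi> t = 1\<close> because
  \<open>\<psi> t < 1\<close> for positive \<open>t\<close>; at \<open>t = 0\<close> the value of
  \<open>\<phi>\<close> is 0.\<close>

lemma beta_less_1:
  assumes "valid t" "\<phi> t \<le> 1"
  shows "\<beta> t < 1"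
proof (cases "t = 0")
  case False
  then have "\<psi> t < 1" using assms by (intro psi_less_1) (auto simp: valid_def)
  moreover have "\<beta> t \<le> \<psi> t * 1"
    unfolding beta_eq[OF assms(1)] using assms psi_pos by (intro mult_left_mono) (auto simp: less_imp_le)
  ultimately show ?thesis by simp
qed (use assms in \<open>simp add: beta_eq\<close>)

text \<open>The quotient \<open>\<gamma> / \<psi>\<close> arises in \<open>new_product_le\<close>
  when displacements are compared with the distances of the new nodes.\<close>

lemma mean_factor_eq:
  assumes "valid t"
  shows "\<gamma> t / \<psi> t = 1 / (1 - (a + b) * t)"
  using denominators_pos[OF assms] by (simp add: gamma_fun_def psi_fun_def)

end

section \<open>The Weierstrass correction and interpolation\<close>

lemma distinct_vecs_iff: "x \<in> distinct_vecs \<longleftrightarrow> (\<forall>i j. i \<noteq> j \<longrightarrow> x $ i \<noteq> x $ j)"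
  by (auto simp: distinct_vecs_def inj_def)

lemma degree_prod_linear: "degree (\<Prod>j\<in>S. [:- u j, 1 :: 'a::field:]) = card S"
  by (subst degree_prod_eq_sum_degree) simp_all

lemma lead_coeff_prod_linear:
  "finite S \<Longrightarrow> coeff (\<Prod>j\<in>S. [:- u j, 1 :: 'a::field:]) (card S) = 1"
  using lead_coeff_prod[of "\<lambda>j. [:- u j, 1 :: 'a:]" S] by (simp add: degree_prod_linear)

text \<open>Turns a Lagrange sum into a product times a sum of partial fractions. With weights 1 it
  is the logarithmic derivative of a product.\<close>

lemma sum_prod_remove:
  fixes u :: "'b \<Rightarrow> 'a::field"
  assumes "finite S" "\<And>j. j \<in> S \<Longrightarrow> u j \<noteq> 0"
  shows "(\<Sum>j\<in>S. w j * (\<Prod>k\<in>S - {j}. u k)) = (\<Prod>j\<in>S. u j) * (\<Sum>j\<in>S. w j / u j)"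
  unfolding sum_distrib_left
  using assms by (intro sum.cong) (auto simp: prod.remove)

lemma poly_pderiv_prod_linear:
  fixes u :: "'b \<Rightarrow> 'a::field"
  assumes "finite S" "\<And>j. j \<in> S \<Longrightarrow> z \<noteq> u j"
  shows "poly (pderiv (\<Prod>j\<in>S. [:- u j, 1:])) z = (\<Prod>j\<in>S. z - u j) * (\<Sum>j\<in>S. 1 / (z - u j))"
  using sum_prod_remove[of S "\<lambda>j. z - u j" "\<lambda>_. 1"] assms
  by (simp add: pderiv_prod pderiv_pCons poly_sum poly_prod)

context
  fixes f :: "'a::field poly" and x :: "'a ^ 'n"
  assumes deg: "degree f = CARD('n)"
begin

lemma lead_coeff_nonzero: "lead_coeff f \<noteq> 0"
proof
  assume "lead_coeff f = 0"
  then have "f = 0" by (simp only: leading_coeff_0_iff)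
  then have "CARD('n) = 0" using deg by simp
  then show False by simp
qed

section \<open>Interpolation formulas and their consequences for one Ehrlich step\<close>

lemma poly_eq_weierstrass:
  assumes "x \<in> distinct_vecs"
  shows "poly f (x $ i) = lead_coeff f * (\<Prod>j\<in>UNIV - {i}. x $ i - x $ j) * weierstrass f x $ i"
  using assms lead_coeff_nonzero by (simp add: weierstrass_def distinct_vecs_iff)

text \<open>Both sides have degree at most \<open>CARD('n)\<close>, the same coefficient there, and
  the same values at \<open>CARD('n)\<close> distinct nodes. This determines the polynomial over
  every field, finite ones included.\<close>

lemma lagrange_weierstrass:
  assumes dist: "x \<in> distinct_vecs"
  shows "f = smult (lead_coeff f) ((\<Prod>j\<in>UNIV. [:- (x $ j), 1:]) +
      (\<Sum>j\<in>UNIV. smult (weierstrass f x $ j) (\<Prod>k\<in>UNIV - {j}. [:- (x $ k), 1:])))"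
    (is "f = ?g")
proof (rule poly_eqI_degree_lead_coeff[where n = "CARD('n)" and A = "range (($) x)"])
  have low: "degree (smult (weierstrass f x $ j) (\<Prod>k\<in>UNIV - {j}. [:- (x $ k), 1:])) < CARD('n)" for j
    by (rule le_less_trans[OF degree_smult_le]) (simp add: degree_prod_linear card_gt_0_iff)
  then have "coeff (\<Sum>j\<in>UNIV. smult (weierstrass f x $ j) (\<Prod>k\<in>UNIV - {j}. [:- (x $ k), 1:])) CARD('n) = 0"
    unfolding coeff_sum by (intro sum.neutral ballI coeff_eq_0)
  then show "coeff f CARD('n) = coeff ?g CARD('n)"
    using lead_coeff_prod_linear[of "UNIV :: 'n set" "($) x"] deg by simp
  show "degree ?g \<le> CARD('n)"
    by (intro order_trans[OF degree_smult_le] degree_add_le degree_sum_le less_imp_le[OF low])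
      (simp_all add: degree_prod_linear)
  show "CARD('n) \<le> card (range (($) x))"
    using dist by (simp add: card_image distinct_vecs_def)
  show "poly f z = poly ?g z" if node: "z \<in> range (($) x)" for z
  proof -
    obtain i where z: "z = x $ i" using node by auto
    \<comment> \<open>At the node \<open>x $ i\<close> only the summand with index \<open>i\<close>
      survives, since every other product contains the factor with \<open>k = i\<close>.\<close>
    have "(\<Prod>k\<in>UNIV - {j}. x $ i - x $ k) = 0" if "j \<in> UNIV - {i}" for j
      using that by (intro prod_zero) auto
    then have "(\<Sum>j\<in>UNIV - {i}. weierstrass f x $ j * (\<Prod>k\<in>UNIV - {j}. x $ i - x $ k)) = 0"
      by (intro sum.neutral ballI) (simp only: mult_zero_right)
    then have "(\<Sum>j\<in>UNIV. weierstrass f x $ j * (\<Prod>k\<in>UNIV - {j}. x $ i - x $ k))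
        = weierstrass f x $ i * (\<Prod>k\<in>UNIV - {i}. x $ i - x $ k)"
      by (subst sum.remove[of _ i]) simp_all
    moreover have "(\<Prod>j\<in>UNIV. x $ i - x $ j) = 0" by (intro prod_zero) auto
    ultimately show ?thesis
      using poly_eq_weierstrass[OF dist, of i] by (simp add: z poly_prod poly_sum)
  qed
qed (use deg in simp)

text \<open>The factor of the node \<open>x $ i\<close> is kept apart, so that evaluating or
  differentiating at this node involves no division by zero.\<close>

lemma lagrange_split:
  assumes dist: "x \<in> distinct_vecs"
  shows "f = smult (lead_coeff f) ([:- (x $ i), 1:] * ((\<Prod>j\<in>UNIV - {i}. [:- (x $ j), 1:]) +
      (\<Sum>j\<in>UNIV - {i}. smult (weierstrass f x $ j) (\<Prod>k\<in>UNIV - {i} - {j}. [:- (x $ k), 1:]))) +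
      smult (weierstrass f x $ i) (\<Prod>j\<in>UNIV - {i}. [:- (x $ j), 1:]))"
proof -
  have "(\<Prod>k\<in>UNIV - {j}. [:- (x $ k), 1:]) = [:- (x $ i), 1:] * (\<Prod>k\<in>UNIV - {i} - {j}. [:- (x $ k), 1:])"
    if "j \<noteq> i" for j
  proof -
    have "UNIV - {j} - {i} = UNIV - {i} - {j}" by auto
    then show ?thesis using that by (subst prod.remove[of _ i]) simp_all
  qed
  then have "(\<Sum>j\<in>UNIV. smult (weierstrass f x $ j) (\<Prod>k\<in>UNIV - {j}. [:- (x $ k), 1:]))
      = smult (weierstrass f x $ i) (\<Prod>j\<in>UNIV - {i}. [:- (x $ j), 1:]) +
        [:- (x $ i), 1:] * (\<Sum>j\<in>UNIV - {i}. smult (weierstrass f x $ j) (\<Prod>k\<in>UNIV - {i} - {j}. [:- (x $ k), 1:]))"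
    unfolding sum_distrib_left
    by (subst sum.remove[of _ i]) (auto intro!: sum.cong simp del: mult_pCons_left)
  moreover have "(\<Prod>j\<in>UNIV. [:- (x $ j), 1:]) = [:- (x $ i), 1:] * (\<Prod>j\<in>UNIV - {i}. [:- (x $ j), 1:])"
    by (rule prod.remove) auto
  ultimately show ?thesis
    using lagrange_weierstrass[OF dist] by (simp add: distrib_left add_ac del: mult_pCons_left)
qed

text \<open>The case \<open>z = x $ i\<close> is included, so a component that does not move in an
  Ehrlich step needs no separate treatment.\<close>

lemma poly_lagrange_weierstrass:
  assumes "x \<in> distinct_vecs" "\<And>j. j \<noteq> i \<Longrightarrow> z \<noteq> x $ j"
  shows "poly f z = lead_coeff f * (\<Prod>j\<in>UNIV - {i}. z - x $ j) *
      ((z - x $ i) * (1 + (\<Sum>j\<in>UNIV - {i}. weierstrass f x $ j / (z - x $ j))) + weierstrass f x $ i)"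
  apply (subst lagrange_split[OF assms(1), of i])
  using sum_prod_remove[of "UNIV - {i}" "\<lambda>j. z - x $ j" "\<lambda>j. weierstrass f x $ j"] assms(2)
  by (simp add: poly_prod poly_sum algebra_simps del: mult_pCons_left)

text \<open>In \<open>lagrange_split\<close> the linear factor vanishes at the node, so of its
  product only the value of the bracket remains; the term with \<open>weierstrass f x $ i\<close>
  contributes a logarithmic derivative.\<close>

lemma poly_pderiv_node:
  assumes "x \<in> distinct_vecs"
  shows "poly (pderiv f) (x $ i) = lead_coeff f * (\<Prod>j\<in>UNIV - {i}. x $ i - x $ j) *
      (1 + (\<Sum>j\<in>UNIV - {i}. weierstrass f x $ j / (x $ i - x $ j)) +
       weierstrass f x $ i * (\<Sum>j\<in>UNIV - {i}. 1 / (x $ i - x $ j)))"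
proof -
  have neq: "x $ i \<noteq> x $ j" if "j \<in> UNIV - {i}" for j
    using assms that by (auto simp: distinct_vecs_iff)
  show ?thesis
    apply (subst lagrange_split[OF assms(1), of i])
    using sum_prod_remove[of "UNIV - {i}" "\<lambda>j. x $ i - x $ j" "\<lambda>j. weierstrass f x $ j"] neq
      poly_pderiv_prod_linear[of "UNIV - {i}" "x $ i" "\<lambda>j. x $ j"]
    by (simp add: pderiv_smult pderiv_add pderiv_mult pderiv_pCons poly_prod poly_sum algebra_simps
        del: mult_pCons_left)
qed

text \<open>The subtracted sum in Ehrlich's denominator cancels the logarithmic derivative in
  \<open>poly_pderiv_node\<close>. The two denominators differ by the nonzero factor
  \<open>P\<close>, so with \<open>z / 0 = 0\<close> the forms agree even where they vanish.\<close>

lemma ehrlich_component: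
  assumes "x \<in> distinct_vecs"
  shows "ehrlich f x $ i = x $ i - weierstrass f x $ i /
      (1 + (\<Sum>j\<in>UNIV - {i}. weierstrass f x $ j / (x $ i - x $ j)))"
proof -
  define P where "P = lead_coeff f * (\<Prod>j\<in>UNIV - {i}. x $ i - x $ j)"
  have "P \<noteq> 0" using assms lead_coeff_nonzero by (auto simp: P_def distinct_vecs_iff)
  have "poly (pderiv f) (x $ i) - poly f (x $ i) * (\<Sum>j\<in>UNIV - {i}. 1 / (x $ i - x $ j))
      = P * (1 + (\<Sum>j\<in>UNIV - {i}. weierstrass f x $ j / (x $ i - x $ j)))"
    by (simp only: poly_pderiv_node[OF assms] poly_eq_weierstrass[OF assms] flip: P_def)
      (simp add: algebra_simps)
  moreover have "poly f (x $ i) = P * weierstrass f x $ i"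
    by (simp only: poly_eq_weierstrass[OF assms] P_def)
  ultimately show ?thesis using \<open>P \<noteq> 0\<close> by (simp add: ehrlich_def)
qed

lemma weierstrass_ehrlich:
  assumes dom: "x \<in> ehrlich_domain f" and y: "y = ehrlich f x"
    and neq: "\<And>j. j \<noteq> i \<Longrightarrow> y $ i \<noteq> x $ j"
  shows "weierstrass f y $ i = - (y $ i - x $ i)\<^sup>2 *
      (\<Sum>j\<in>UNIV - {i}. weierstrass f x $ j / ((y $ i - x $ j) * (x $ i - x $ j))) *
      (\<Prod>j\<in>UNIV - {i}. (y $ i - x $ j) / (y $ i - y $ j))"
proof -
  define s t where "s = (\<Sum>j\<in>UNIV - {i}. weierstrass f x $ j / (x $ i - x $ j))"
    and "t = (\<Sum>j\<in>UNIV - {i}. weierstrass f x $ j / (y $ i - x $ j))"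
  define u where "u = y $ i - x $ i"
  have dist: "x \<in> distinct_vecs" and s: "1 + s \<noteq> 0" using dom by (auto simp: ehrlich_domain_def s_def)
  \<comment> \<open>The equation of the step is solved for the correction. Inserted into the
    interpolation formula at \<open>y $ i\<close>, it leaves only
    \<open>u * (t - s)\<close>.\<close>
  have "weierstrass f x $ i = - u * (1 + s)"
    using s by (simp add: u_def y ehrlich_component[OF dist] flip: s_def)
  then have "u * (1 + t) + weierstrass f x $ i = u * (t - s)" by (simp add: algebra_simps)
  \<comment> \<open>Subtracting partial fractions yields the second factor \<open>u\<close>.\<close>
  also have "t - s = - u * (\<Sum>j\<in>UNIV - {i}. weierstrass f x $ j / ((y $ i - x $ j) * (x $ i - x $ j)))"
    unfolding t_def s_def sum_distrib_left sum_subtractf[symmetric]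
  proof (intro sum.cong refl)
    fix j assume "j \<in> UNIV - {i}"
    then have "y $ i - x $ j \<noteq> 0" "x $ i - x $ j \<noteq> 0" using neq dist by (auto simp: distinct_vecs_iff)
    then show "weierstrass f x $ j / (y $ i - x $ j) - weierstrass f x $ j / (x $ i - x $ j)
        = - u * (weierstrass f x $ j / ((y $ i - x $ j) * (x $ i - x $ j)))"
      by (simp add: u_def divide_simps) (simp add: algebra_simps)
  qed
  finally have "poly f (y $ i) = lead_coeff f * (\<Prod>j\<in>UNIV - {i}. y $ i - x $ j) *
      (u * (- u * (\<Sum>j\<in>UNIV - {i}. weierstrass f x $ j / ((y $ i - x $ j) * (x $ i - x $ j)))))"
    (is "_ = _ * _ * (u * (- u * ?s))")
    by (simp only: poly_lagrange_weierstrass[OF dist neq] flip: u_def t_def)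
  then have "poly f (y $ i) = lead_coeff f * ((\<Prod>j\<in>UNIV - {i}. y $ i - x $ j) * (- u\<^sup>2 * ?s))"
    by (simp only: power2_eq_square mult_minus_left mult_minus_right mult.assoc)
  moreover have "weierstrass f y $ i = poly f (y $ i) / (lead_coeff f * (\<Prod>j\<in>UNIV - {i}. y $ i - y $ j))"
    by (simp add: weierstrass_def)
  ultimately have "weierstrass f y $ i
      = (\<Prod>j\<in>UNIV - {i}. y $ i - x $ j) * (- u\<^sup>2 * ?s) / (\<Prod>j\<in>UNIV - {i}. y $ i - y $ j)"
    using lead_coeff_nonzero by (simp only: nonzero_mult_divide_mult_cancel_left not_False_eq_True)
  also have "\<dots> = - u\<^sup>2 * ?s * (\<Prod>j\<in>UNIV - {i}. (y $ i - x $ j) / (y $ i - y $ j))"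
    by (simp only: prod_dividef times_divide_eq_right mult.commute[of _ "prod _ _"])
  finally show ?thesis by (simp only: u_def)
qed

text \<open>Shows that the correction is asymptotically the error: the product tends to 1 when
  \<open>x\<close> tends to a \<open>\<xi>\<close> with distinct components.\<close>

lemma weierstrass_root_vector:
  assumes "root_vector f \<xi>"
  shows "weierstrass f x $ i = (x $ i - \<xi> $ i) * (\<Prod>j\<in>UNIV - {i}. (x $ i - \<xi> $ j) / (x $ i - x $ j))"
proof -
  have "poly f (x $ i) = lead_coeff f * (\<Prod>j\<in>UNIV. x $ i - \<xi> $ j)"
    by (subst assms[unfolded root_vector_def]) (simp add: poly_prod)
  also have "(\<Prod>j\<in>UNIV. x $ i - \<xi> $ j) = (x $ i - \<xi> $ i) * (\<Prod>j\<in>UNIV - {i}. x $ i - \<xi> $ j)"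
    by (rule prod.remove) auto
  finally show ?thesis
    using lead_coeff_nonzero by (simp add: weierstrass_def prod_dividef)
qed

lemma simple_zeros_root_vector:
  assumes "root_vector f \<xi>" "\<xi> \<in> distinct_vecs"
  shows "{z. poly f z = 0} = range (($) \<xi>)"
    and "{z. poly f z = 0 \<and> order z f = 1} = range (($) \<xi>)"
proof -
  have root: "poly f z = 0 \<longleftrightarrow> z \<in> range (($) \<xi>)" for z
    by (subst assms(1)[unfolded root_vector_def]) (use lead_coeff_nonzero in \<open>auto simp: poly_prod\<close>)
  then show "{z. poly f z = 0} = range (($) \<xi>)" by blast
  have "order (\<xi> $ i) f = 1" for i
  proof -
    \<comment> \<open>The cofactor of one linear factor does not vanish at the root of that factor,
      hence the order is exactly 1.\<close>
    have "f = [:- (\<xi> $ i), 1:] * smult (lead_coeff f) (\<Prod>j\<in>UNIV - {i}. [:- (\<xi> $ j), 1:])"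
      (is "f = ?l * ?g")
      by (subst assms(1)[unfolded root_vector_def], subst prod.remove[of _ i])
        (simp_all del: mult_pCons_left)
    moreover have "f \<noteq> 0" using lead_coeff_nonzero by auto
    moreover have "poly ?g (\<xi> $ i) \<noteq> 0"
      using lead_coeff_nonzero assms(2) by (auto simp: poly_prod distinct_vecs_iff)
    moreover have "order (\<xi> $ i) ?l = 1"
      using order_power_n_n[of "\<xi> $ i" 1] by simp
    ultimately show ?thesis
      using order_mult[of ?l ?g "\<xi> $ i"] order_root[of ?g "\<xi> $ i"] by simp
  qed
  then show "{z. poly f z = 0 \<and> order z f = 1} = range (($) \<xi>)" using root by auto
qed

end

text \<open>Each coefficient of the interpolation formula equals that of \<open>f\<close> for every
  \<open>k\<close>, and the terms with the corrections tend to 0. The argument covers limits with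
  coinciding components.\<close>

lemma root_vector_limit:
  fixes f :: "'a::complete_normed_field poly" and x :: "nat \<Rightarrow> 'a ^ 'n"
  assumes deg: "degree f = CARD('n)" and dist: "\<And>k. x k \<in> distinct_vecs"
    and lim: "x \<longlonglongrightarrow> \<xi>" and W: "\<And>i. (\<lambda>k. weierstrass f (x k) $ i) \<longlonglongrightarrow> 0"
  shows "root_vector f \<xi>"
  unfolding root_vector_def
proof (rule poly_eqI)
  fix m
  have lin: "(\<lambda>k. coeff [:- (x k $ j), 1:] m) \<longlonglongrightarrow> coeff [:- (\<xi> $ j), 1:] m" for j m
  proof (cases m)
    case 0
    have "(\<lambda>k. abs_val (x k $ j - \<xi> $ j)) \<longlonglongrightarrow> 0"
      using tendsto_vec_nth[OF lim, of j] by (simp add: tendsto_abs_val_iff)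
    then show ?thesis using 0 by (simp add: tendsto_abs_val_iff abs_val_minus_commute)
  qed simp
  let ?P = "\<lambda>S x. \<Prod>j\<in>S. [:- (x $ j), 1:]"
  have prod: "(\<lambda>k. coeff (?P S (x k)) m) \<longlonglongrightarrow> coeff (?P S \<xi>) m" for S m
    by (intro tendsto_coeff_prod lin)
  have "(\<lambda>k. lead_coeff f * (coeff (?P UNIV (x k)) m +
        (\<Sum>j\<in>UNIV. weierstrass f (x k) $ j * coeff (?P (UNIV - {j}) (x k)) m)))
      \<longlonglongrightarrow> lead_coeff f * (coeff (?P UNIV \<xi>) m + (\<Sum>j\<in>UNIV. 0 * coeff (?P (UNIV - {j}) \<xi>) m))"
    by (intro tendsto_field_mult tendsto_field_add tendsto_field_sum prod W tendsto_const)
  moreover have "lead_coeff f * (coeff (?P UNIV (x k)) m +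
        (\<Sum>j\<in>UNIV. weierstrass f (x k) $ j * coeff (?P (UNIV - {j}) (x k)) m)) = coeff f m" for k
    using arg_cong[OF lagrange_weierstrass[OF deg dist[of k]], of "\<lambda>p. coeff p m"]
    by (simp add: coeff_sum)
  ultimately have "(\<lambda>k :: nat. coeff f m) \<longlonglongrightarrow> lead_coeff f * coeff (?P UNIV \<xi>) m" by simp
  then show "coeff f m = coeff (smult (lead_coeff f) (?P UNIV \<xi>)) m"
    by (simp add: LIMSEQ_const_iff)
qed

section \<open>One step of the iteration\<close>

lemma separation_le: "j \<noteq> i \<Longrightarrow> separation x $ i \<le> abs_val (x $ i - x $ j)"
  by (auto simp: separation_def intro!: Min_le)

lemma others_nonempty: "2 \<le> CARD('n) \<Longrightarrow> UNIV - {i :: 'n::finite} \<noteq> {}"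
  using card_Diff_singleton[of i "UNIV :: 'n set"] by (metis One_nat_def Suc_1 UNIV_I card.empty
      diff_is_0_eq not_less_eq_eq)

lemma separation_greatest:
  fixes x :: "'a::complete_normed_field ^ 'n"
  assumes "2 \<le> CARD('n)" "\<And>j. j \<noteq> i \<Longrightarrow> c \<le> abs_val (x $ i - x $ j)"
  shows "c \<le> separation x $ i"
  using others_nonempty[OF assms(1), of i] assms(2) by (simp add: separation_def)

lemma separation_pos:
  fixes x :: "'a::complete_normed_field ^ 'n"
  assumes "2 \<le> CARD('n)" "x \<in> distinct_vecs"
  shows "0 < separation x $ i"
  using others_nonempty[OF assms(1), of i] assms(2)
  by (auto simp: separation_def Min_gr_iff abs_val_pos_iff distinct_vecs_iff)

text \<open>A single vector with \<open>E\<close> in the valid range. The assumptions are arranged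
  so that they can be re-established at each iterate.\<close>

locale ehrlich_step = degree_exponent n q for n q +
  fixes f :: "'a::complete_normed_field poly" and p :: ereal and x :: "'a ^ 'n"
  assumes deg: "degree f = n" and dim: "CARD('n) = n"
    and p_ge_1: "1 \<le> p" and conjugate: "1 / p + 1 / q = 1"
    and distinct: "x \<in> distinct_vecs"
    and valid_E: "valid (E_fun p f x)"
begin

abbreviation "W \<equiv> weierstrass f x"
abbreviation "d \<equiv> separation x"
abbreviation "E \<equiv> E_fun p f x"
abbreviation "y \<equiv> ehrlich f x"

lemma deg_card: "degree f = CARD('n)"
  using deg dim by simp

lemma d_pos: "0 < d $ i"
  using separation_pos distinct dim n_ge_2 by metis

lemma E_nonneg: "0 \<le> E"
  using valid_E by (simp add: valid_def)

lemma quot_nonneg: "0 \<le> abs_val (W $ i) / d $ i"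
  by (intro divide_nonneg_pos abs_val_nonneg d_pos)

lemma sum_quot_le: "(\<Sum>i\<in>S. abs_val (W $ i) / d $ i) \<le> real (card S) powr real_of_ereal (1 / q) * E"
  using sum_le_p_norm[OF p_ge_1 q_ge_1 conjugate, where v = "vec_quot W d" and S = S]
  by (simp add: vec_quot_def E_fun_def abs_of_pos[OF d_pos] abs_of_nonneg[OF abs_val_nonneg])

lemma sum_others_le: "(\<Sum>j\<in>UNIV - {i}. abs_val (W $ j) / d $ j) \<le> a * E"
  using sum_quot_le[of "UNIV - {i}"] n_ge_2 by (simp add: dim coeff_a_def of_nat_diff)

lemma pair_quot_le: "i \<noteq> j \<Longrightarrow> abs_val (W $ i) / d $ i + abs_val (W $ j) / d $ j \<le> b * E"
  using sum_quot_le[of "{i, j}"] by (simp add: coeff_b_def)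

lemma quot_le_E: "abs_val (W $ i) / d $ i \<le> E"
  using sum_quot_le[of "{i}"] by simp

lemma W_le: "j \<noteq> i \<Longrightarrow> abs_val (W $ i) \<le> abs_val (W $ i) / d $ i * abs_val (x $ i - x $ j)"
  using mult_left_mono[OF separation_le[of j i x] quot_nonneg[of i]] d_pos[of i] by simp

lemma quot_nodes_le: "j \<noteq> i \<Longrightarrow> abs_val (W $ j / (x $ i - x $ j)) \<le> abs_val (W $ j) / d $ j"
  unfolding abs_val_divide
  using separation_le[of i j x] d_pos[of j] distinct
  by (intro divide_left_mono mult_pos_pos)
    (auto simp: abs_val_nonneg abs_val_pos_iff distinct_vecs_iff abs_val_minus_commute)

text \<open>The reverse triangle inequality with Hoelder's inequality over the \<open>n - 1\<close>
  other indices. It yields both membership in the domain and the factor \<open>\<gamma>\<close> of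
  the displacement.\<close>

lemma denominator_ge:
  "1 - a * E \<le> abs_val (1 + (\<Sum>j\<in>UNIV - {i}. W $ j / (x $ i - x $ j)))"
proof -
  have "abs_val (\<Sum>j\<in>UNIV - {i}. W $ j / (x $ i - x $ j)) \<le> (\<Sum>j\<in>UNIV - {i}. abs_val (W $ j) / d $ j)"
    by (rule order_trans[OF abs_val_sum_le]) (auto intro!: sum_mono quot_nodes_le)
  also have "\<dots> \<le> a * E" by (rule sum_others_le)
  finally show ?thesis
    using abs_val_diff_ge[of 1 "- (\<Sum>j\<in>UNIV - {i}. W $ j / (x $ i - x $ j))"] by (simp add: abs_val_minus)
qed

lemma in_domain: "x \<in> ehrlich_domain f"
proof -
  have "1 + (\<Sum>j\<in>UNIV - {i}. W $ j / (x $ i - x $ j)) \<noteq> 0" for i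
  proof
    assume "1 + (\<Sum>j\<in>UNIV - {i}. W $ j / (x $ i - x $ j)) = 0"
    then have "1 - a * E \<le> 0" using denominator_ge[of i] by (simp only: abs_val_0)
    then show False using denominators_pos(1)[OF valid_E] by simp
  qed
  then show ?thesis using distinct by (simp add: ehrlich_domain_def)
qed

lemma displacement_le: "abs_val (y $ i - x $ i) \<le> \<gamma> E * abs_val (W $ i)"
proof -
  have "abs_val (y $ i - x $ i)
      = abs_val (W $ i) / abs_val (1 + (\<Sum>j\<in>UNIV - {i}. W $ j / (x $ i - x $ j)))"
    by (simp add: ehrlich_component[OF deg_card distinct] abs_val_minus abs_val_divide)
  also have "\<dots> \<le> abs_val (W $ i) / (1 - a * E)"
    using denominators_pos(1)[OF valid_E] denominator_ge[of i]
    by (intro divide_left_mono mult_pos_pos abs_val_nonneg) auto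
  finally show ?thesis by (simp add: gamma_fun_def)
qed

text \<open>The displacements of both nodes are estimated jointly by Hoelder's inequality for the
  pair, which gives \<open>b\<close> in place of 2.\<close>

lemma new_nodes_dist_ge:
  assumes "i \<noteq> j"
  shows "\<psi> E * abs_val (x $ i - x $ j) \<le> abs_val (y $ i - y $ j)"
proof -
  let ?D = "abs_val (x $ i - x $ j)"
  have "abs_val (W $ i) + abs_val (W $ j) \<le> (abs_val (W $ i) / d $ i + abs_val (W $ j) / d $ j) * ?D"
    using W_le[of j i] W_le[of i j] assms by (simp add: distrib_right abs_val_minus_commute)
  also have "\<dots> \<le> b * E * ?D"
    using pair_quot_le[OF assms] by (intro mult_right_mono abs_val_nonneg)
  finally have "\<gamma> E * (abs_val (W $ i) + abs_val (W $ j)) \<le> \<gamma> E * (b * E * ?D)"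
    using gamma_ge_1[OF valid_E] by (intro mult_left_mono) auto
  moreover have "abs_val ((x $ i - y $ i) + (y $ j - x $ j)) \<le> \<gamma> E * (abs_val (W $ i) + abs_val (W $ j))"
    using abs_val_triangle[of "x $ i - y $ i" "y $ j - x $ j"] displacement_le[of i] displacement_le[of j]
    by (simp add: distrib_left abs_val_minus_commute)
  moreover have "?D - abs_val ((x $ i - y $ i) + (y $ j - x $ j)) \<le> abs_val (y $ i - y $ j)"
    using abs_val_diff_ge[of "x $ i - x $ j" "(x $ i - y $ i) + (y $ j - x $ j)"] by simp
  moreover have "\<psi> E = 1 - \<gamma> E * b * E"
    using one_minus_psi[OF valid_E] by linarith
  then have "\<psi> E * ?D = ?D - \<gamma> E * (b * E * ?D)"
    by (simp add: left_diff_distrib)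
  ultimately show ?thesis by linarith
qed

lemma new_distinct: "y \<in> distinct_vecs"
  unfolding distinct_vecs_iff
proof (intro allI impI)
  fix i j :: 'n assume "i \<noteq> j"
  then have "0 < \<psi> E * abs_val (x $ i - x $ j)"
    using distinct psi_pos[OF valid_E] by (intro mult_pos_pos) (auto simp: abs_val_pos_iff distinct_vecs_iff)
  then have "0 < abs_val (y $ i - y $ j)" using new_nodes_dist_ge[OF \<open>i \<noteq> j\<close>] by linarith
  then show "y $ i \<noteq> y $ j" by (auto simp: abs_val_pos_iff)
qed

lemma new_separation_ge: "\<psi> E * d $ i \<le> separation y $ i"
proof (rule separation_greatest)
  fix j assume "j \<noteq> i"
  then have "\<psi> E * d $ i \<le> \<psi> E * abs_val (x $ i - x $ j)"
    using psi_pos[OF valid_E] by (intro mult_left_mono separation_le) auto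
  also have "\<dots> \<le> abs_val (y $ i - y $ j)" using \<open>j \<noteq> i\<close> by (intro new_nodes_dist_ge) auto
  finally show "\<psi> E * d $ i \<le> abs_val (y $ i - y $ j)" .
qed (use dim n_ge_2 in simp)

text \<open>The left side compares a moved node with an old one. Only one node moves, hence
  \<open>a + 1\<close> where two moving nodes give \<open>a + b\<close>.\<close>

lemma mixed_factor_eq: "1 - \<gamma> E * E = (1 - (a + 1) * E) / (1 - a * E)"
  using denominators_pos[OF valid_E] by (simp add: gamma_fun_def field_simps)

lemma mixed_factor_pos: "0 < 1 - \<gamma> E * E"
  unfolding mixed_factor_eq using denominators_pos[OF valid_E] by simp

lemma mixed_dist_ge:
  assumes "j \<noteq> i"
  shows "(1 - \<gamma> E * E) * abs_val (x $ i - x $ j) \<le> abs_val (y $ i - x $ j)"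
proof -
  let ?D = "abs_val (x $ i - x $ j)"
  have "abs_val (W $ i) \<le> E * ?D"
    using W_le[OF assms] mult_right_mono[OF quot_le_E[of i] abs_val_nonneg[of "x $ i - x $ j"]] by linarith
  then have "\<gamma> E * abs_val (W $ i) \<le> \<gamma> E * (E * ?D)"
    using gamma_ge_1[OF valid_E] by (intro mult_left_mono) auto
  moreover have "?D - abs_val (x $ i - y $ i) \<le> abs_val (y $ i - x $ j)"
    using abs_val_diff_ge[of "x $ i - x $ j" "x $ i - y $ i"] by simp
  ultimately show ?thesis
    using displacement_le[of i] by (simp add: algebra_simps abs_val_minus_commute)
qed

text \<open>Since \<open>y $ i - x $ j\<close> is \<open>y $ i - y $ j\<close> plus the displacement
  of node \<open>j\<close>, each factor is at most 1 plus a multiple of a quotient. The means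
  inequality and the bound \<open>a * E\<close> for the sum of the quotients then apply.\<close>

lemma new_product_le:
  "abs_val (\<Prod>j\<in>UNIV - {i}. (y $ i - x $ j) / (y $ i - y $ j))
    \<le> (1 + a * E / ((real n - 1) * (1 - (a + b) * E))) ^ (n - 1)"
proof -
  let ?c = "\<gamma> E / \<psi> E"
  have c: "0 \<le> ?c" using gamma_ge_1[OF valid_E] psi_pos[OF valid_E] by simp
  have "abs_val ((y $ i - x $ j) / (y $ i - y $ j)) \<le> 1 + ?c * (abs_val (W $ j) / d $ j)"
    if "j \<in> UNIV - {i}" for j
  proof -
    have yy: "abs_val (y $ i - y $ j) > 0"
      using new_distinct that by (auto simp: abs_val_pos_iff distinct_vecs_iff)
    have "abs_val (y $ j - x $ j) \<le> \<gamma> E * (abs_val (W $ j) / d $ j * abs_val (x $ i - x $ j))"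
      using that W_le[of i j] gamma_ge_1[OF valid_E]
      by (intro order_trans[OF displacement_le] mult_left_mono)
        (auto simp: abs_val_minus_commute[of "x $ i"])
    also have "\<dots> = ?c * (abs_val (W $ j) / d $ j) * (\<psi> E * abs_val (x $ i - x $ j))"
      using psi_pos[OF valid_E] by simp
    also have "\<dots> \<le> ?c * (abs_val (W $ j) / d $ j) * abs_val (y $ i - y $ j)"
      using that c quot_nonneg[of j] by (intro mult_left_mono new_nodes_dist_ge mult_nonneg_nonneg) auto
    finally have "abs_val (y $ i - y $ j) + abs_val (y $ j - x $ j)
        \<le> (1 + ?c * (abs_val (W $ j) / d $ j)) * abs_val (y $ i - y $ j)"
      by (simp only: distrib_right mult_1_left add_left_mono)
    moreover have "abs_val (y $ i - x $ j) \<le> abs_val (y $ i - y $ j) + abs_val (y $ j - x $ j)"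
      using abs_val_triangle[of "y $ i - y $ j" "y $ j - x $ j"] by simp
    ultimately show ?thesis unfolding abs_val_divide using yy by (simp add: pos_divide_le_eq)
  qed
  then have "abs_val (\<Prod>j\<in>UNIV - {i}. (y $ i - x $ j) / (y $ i - y $ j))
      \<le> (\<Prod>j\<in>UNIV - {i}. 1 + ?c * (abs_val (W $ j) / d $ j))"
    unfolding abs_val_prod by (intro prod_mono) (simp add: abs_val_nonneg)
  also have "\<dots> \<le> (1 + (\<Sum>j\<in>UNIV - {i}. ?c * (abs_val (W $ j) / d $ j)) / card (UNIV - {i}))
      ^ card (UNIV - {i})"
    using c quot_nonneg by (intro prod_one_plus_le_mean_power mult_nonneg_nonneg) auto
  also have "\<dots> = (1 + ?c * (\<Sum>j\<in>UNIV - {i}. abs_val (W $ j) / d $ j) / (real n - 1)) ^ (n - 1)"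
    using n_ge_2 by (simp add: dim of_nat_diff flip: sum_distrib_left del: times_divide_eq_left times_divide_eq_right)
  also have "\<dots> \<le> (1 + ?c * (a * E) / (real n - 1)) ^ (n - 1)"
  proof -
    have n: "0 \<le> real n - 1" using n_ge_2 by simp
    have "0 \<le> ?c * (\<Sum>j\<in>UNIV - {i}. abs_val (W $ j) / d $ j) / (real n - 1)"
      by (intro divide_nonneg_nonneg mult_nonneg_nonneg sum_nonneg quot_nonneg c n)
    moreover have "?c * (\<Sum>j\<in>UNIV - {i}. abs_val (W $ j) / d $ j) / (real n - 1) \<le> ?c * (a * E) / (real n - 1)"
      by (intro divide_right_mono mult_left_mono sum_others_le c n)
    ultimately show ?thesis by (intro power_mono) linarith+
  qed
  also have "?c * (a * E) / (real n - 1) = a * E / ((real n - 1) * (1 - (a + b) * E))"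
    by (simp add: mean_factor_eq[OF valid_E] mult.commute)
  finally show ?thesis .
qed

lemma new_W_le: "abs_val (weierstrass f y $ i) \<le> \<beta> E * abs_val (W $ i)"
proof -
  let ?g = "\<gamma> E" and ?m = "1 - \<gamma> E * E"
  have g: "0 \<le> ?g" using gamma_ge_1[OF valid_E] by simp
  have xx: "0 < abs_val (x $ i - x $ j)" if "j \<noteq> i" for j
    using that distinct by (auto simp: abs_val_pos_iff distinct_vecs_iff)
  have yx: "y $ i \<noteq> x $ j" if "j \<noteq> i" for j
  proof -
    have "0 < abs_val (y $ i - x $ j)"
      using mixed_dist_ge[OF that] mult_pos_pos[OF mixed_factor_pos xx[OF that]] by linarith
    then show ?thesis by (simp add: abs_val_pos_iff)
  qed
  \<comment> \<open>The two differences are bounded by different separations: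
    \<open>x $ i - x $ j\<close> by \<open>d $ j\<close>, to form the quotient of index
    \<open>j\<close>, and \<open>y $ i - x $ j\<close> by a multiple of \<open>d $ i\<close>, to be
    paired with \<open>W $ i\<close> below.\<close>
  have "abs_val (\<Sum>j\<in>UNIV - {i}. W $ j / ((y $ i - x $ j) * (x $ i - x $ j)))
      \<le> (\<Sum>j\<in>UNIV - {i}. abs_val (W $ j) / d $ j / (?m * d $ i))"
  proof (rule order_trans[OF abs_val_sum_le], rule sum_mono)
    fix j assume "j \<in> UNIV - {i}"
    then have j: "j \<noteq> i" by simp
    have "?m * d $ i \<le> ?m * abs_val (x $ i - x $ j)"
      using mixed_factor_pos by (intro mult_left_mono separation_le[OF j]) auto
    then have "?m * d $ i \<le> abs_val (y $ i - x $ j)" using mixed_dist_ge[OF j] by linarith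
    then have "abs_val (W $ j / (x $ i - x $ j)) / abs_val (y $ i - x $ j)
        \<le> abs_val (W $ j) / d $ j / (?m * d $ i)"
      using mixed_factor_pos d_pos[of i] quot_nonneg[of j]
      by (intro frac_le quot_nodes_le[OF j] mult_pos_pos) auto
    then show "abs_val (W $ j / ((y $ i - x $ j) * (x $ i - x $ j))) \<le> abs_val (W $ j) / d $ j / (?m * d $ i)"
      by (simp add: abs_val_divide abs_val_mult mult.commute)
  qed
  also have "\<dots> \<le> a * E / (?m * d $ i)"
    unfolding sum_divide_distrib[symmetric]
    using mixed_factor_pos d_pos[of i] by (intro divide_right_mono sum_others_le) auto
  finally have sum: "abs_val (\<Sum>j\<in>UNIV - {i}. W $ j / ((y $ i - x $ j) * (x $ i - x $ j)))
      \<le> a * E / (?m * d $ i)" .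
  have "(abs_val (y $ i - x $ i))\<^sup>2 \<le> (?g * abs_val (W $ i))\<^sup>2"
    by (intro power_mono displacement_le abs_val_nonneg)
  then have "(abs_val (y $ i - x $ i))\<^sup>2 * abs_val (\<Sum>j\<in>UNIV - {i}. W $ j / ((y $ i - x $ j) * (x $ i - x $ j)))
      \<le> (?g * abs_val (W $ i))\<^sup>2 * (a * E / (?m * d $ i))"
    using sum by (intro mult_mono abs_val_nonneg) auto
  \<comment> \<open>One of the two factors \<open>abs_val (W $ i)\<close> from the squared
    displacement joins \<open>1 / d $ i\<close> to a quotient bounded by \<open>E\<close>; the other
    one remains.\<close>
  also have "\<dots> = ?g\<^sup>2 / ?m * a * E * (abs_val (W $ i) / d $ i) * abs_val (W $ i)"
    by (simp add: power2_eq_square)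
  also have "\<dots> \<le> ?g\<^sup>2 / ?m * a * E * E * abs_val (W $ i)"
    using quot_le_E[of i] a_ge_1 mixed_factor_pos E_nonneg
    by (intro mult_right_mono mult_left_mono abs_val_nonneg mult_nonneg_nonneg) auto
  also have "\<dots> = a * E\<^sup>2 / ((1 - a * E) * (1 - (a + 1) * E)) * abs_val (W $ i)"
    using denominators_pos[OF valid_E] unfolding mixed_factor_eq
    by (simp add: gamma_fun_def power2_eq_square)
  finally have front: "(abs_val (y $ i - x $ i))\<^sup>2 *
      abs_val (\<Sum>j\<in>UNIV - {i}. W $ j / ((y $ i - x $ j) * (x $ i - x $ j)))
      \<le> a * E\<^sup>2 / ((1 - a * E) * (1 - (a + 1) * E)) * abs_val (W $ i)" .
  have "abs_val (weierstrass f y $ i) = (abs_val (y $ i - x $ i))\<^sup>2 *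
      abs_val (\<Sum>j\<in>UNIV - {i}. W $ j / ((y $ i - x $ j) * (x $ i - x $ j))) *
      abs_val (\<Prod>j\<in>UNIV - {i}. (y $ i - x $ j) / (y $ i - y $ j))"
    using yx by (subst weierstrass_ehrlich[OF deg_card in_domain refl])
      (auto simp: abs_val_mult abs_val_minus power2_eq_square)
  also have "\<dots> \<le> a * E\<^sup>2 / ((1 - a * E) * (1 - (a + 1) * E)) * abs_val (W $ i) *
      (1 + a * E / ((real n - 1) * (1 - (a + b) * E))) ^ (n - 1)"
    using denominators_pos[OF valid_E] a_ge_1
    by (intro mult_mono[OF front new_product_le]) (auto simp: abs_val_nonneg)
  also have "\<dots> = \<beta> E * abs_val (W $ i)" by (simp add: beta_fun_def Let_def)
  finally show ?thesis .
qed

lemma new_E_le: "E_fun p f y \<le> \<phi> E * E"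
proof -
  have "abs_val (weierstrass f y $ i) / separation y $ i \<le> \<phi> E * (abs_val (W $ i) / d $ i)" for i
  proof -
    have "abs_val (weierstrass f y $ i) / separation y $ i \<le> \<beta> E * abs_val (W $ i) / (\<psi> E * d $ i)"
      using new_W_le[of i] new_separation_ge[of i] psi_pos[OF valid_E] d_pos[of i] beta_nonneg[OF valid_E]
      by (intro frac_le mult_pos_pos mult_nonneg_nonneg abs_val_nonneg)
    then show ?thesis using psi_pos[OF valid_E] by (simp add: beta_eq[OF valid_E])
  qed
  moreover have "0 < separation y $ i" for i
    using separation_pos new_distinct dim n_ge_2 by metis
  ultimately show ?thesis
    unfolding E_fun_def using phi_nonneg[OF valid_E, unfolded E_fun_def] d_pos
    by (intro p_norm_mono_scale[OF p_ge_1])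
      (auto simp: vec_quot_def abs_val_nonneg abs_of_pos E_fun_def)
qed

end

section \<open>The iteration\<close>

text \<open>Powers of 3 are odd, so the truncating division is exact. The exponent is the sum of
  \<open>3 ^ j\<close> over \<open>j < k\<close>.\<close>

lemma half_power3:
  "2 * (((3 :: nat) ^ k - 1) div 2) + 1 = 3 ^ k"
  "((3 :: nat) ^ Suc k - 1) div 2 = ((3 :: nat) ^ k - 1) div 2 + 3 ^ k"
proof -
  show *: "2 * (((3 :: nat) ^ k - 1) div 2) + 1 = 3 ^ k" for k :: nat
  proof -
    have "odd ((3 :: nat) ^ k)" by simp
    then obtain m where "(3 :: nat) ^ k = 2 * m + 1" by (rule oddE)
    then show ?thesis by simp
  qed
  show "((3 :: nat) ^ Suc k - 1) div 2 = ((3 :: nat) ^ k - 1) div 2 + 3 ^ k"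
    using *[of k] *[of "Suc k"] by simp
qed

lemma power_half_power3: "(c ^ ((3 ^ k - 1) div 2))\<^sup>2 * c = (c :: real) ^ 3 ^ k"
proof -
  have "(c ^ ((3 ^ k - 1) div 2))\<^sup>2 * c = c ^ (2 * ((3 ^ k - 1) div 2) + 1)"
    by (simp only: power_add power_mult mult.commute[of 2] power_one_right)
  then show ?thesis by (simp only: half_power3(1))
qed

lemma ehrlich_iter_0 [simp]: "ehrlich_iter f x 0 = x"
  by (simp add: ehrlich_iter_def)

lemma ehrlich_iter_Suc: "ehrlich_iter f x (Suc k) = ehrlich f (ehrlich_iter f x k)"
  by (simp add: ehrlich_iter_def)

lemma ehrlich_iter_add: "ehrlich_iter f (ehrlich_iter f x k) j = ehrlich_iter f x (k + j)"
  by (simp add: ehrlich_iter_def funpow_add add.commute[of k])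

lemma ehrlich_iter_shift: "ehrlich_iter f (ehrlich_iter f x k) = (\<lambda>j. ehrlich_iter f x (j + k))"
  by (simp add: fun_eq_iff ehrlich_iter_add add.commute)

text \<open>Estimates are proved for the starting vector. By \<open>iteration\<close> below every
  iterate satisfies the same assumptions, so interpreting the locale at \<open>x k\<close> transfers
  them to all \<open>k\<close>.\<close>

locale ehrlich_iteration = ehrlich_step n q f p x0
  for n q and f :: "'a::complete_normed_field poly" and p and x0 :: "'a ^ 'n" +
  assumes phi_le_1: "\<phi> (E_fun p f x0) \<le> 1"
begin

abbreviation "x \<equiv> ehrlich_iter f x0"

lemma phi_E_nonneg: "0 \<le> \<phi> E"
  by (rule phi_nonneg[OF valid_E])

lemma phi_E_power: "0 \<le> \<phi> E ^ m" "\<phi> E ^ m \<le> 1"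
  using phi_E_nonneg phi_le_1 by (auto intro: power_le_one)

lemma psi_E: "0 < \<psi> E" "\<psi> E \<le> 1"
  using psi_pos[OF valid_E] psi_le_1[OF valid_E] by auto

text \<open>A joint induction: the bound at \<open>Suc k\<close> uses the step at \<open>k\<close>,
  and the step at \<open>Suc k\<close> needs the bound to stay in the valid range. With
  \<open>m = (3 ^ k - 1) div 2\<close>, \<open>phi_scale\<close> bounds \<open>\<phi>\<close> at
  iterate \<open>k\<close> by \<open>\<phi> E\<close> to the power \<open>2 * m + 1 = 3 ^ k\<close>,
  and the exponents add up.\<close>

lemma step_and_E_le:
  "ehrlich_step n q f p (x k) \<and> E_fun p f (x k) \<le> \<phi> E ^ ((3 ^ k - 1) div 2) * E"
proof (induction k)
  case 0
  then show ?case by (simp add: ehrlich_step_axioms)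
next
  case (Suc k)
  interpret k: ehrlich_step n q f p "x k" using Suc by blast
  let ?m = "(3 ^ k - 1) div 2 :: nat"
  have "\<phi> k.E \<le> \<phi> (\<phi> E ^ ?m * E)"
    using Suc valid_mono[OF valid_E] E_nonneg phi_E_power k.E_nonneg
    by (intro phi_mono valid_mono[OF valid_E] mult_left_le_one_le) auto
  also have "\<dots> \<le> (\<phi> E ^ ?m)\<^sup>2 * \<phi> E"
    using phi_E_power by (intro phi_scale valid_E)
  also have "\<dots> = \<phi> E ^ 3 ^ k"
    by (rule power_half_power3)
  finally have phi: "\<phi> k.E \<le> \<phi> E ^ 3 ^ k" .
  have "E_fun p f (x (Suc k)) \<le> \<phi> k.E * k.E"
    unfolding ehrlich_iter_Suc by (rule k.new_E_le)
  also have "\<dots> \<le> \<phi> E ^ 3 ^ k * (\<phi> E ^ ?m * E)"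
    using phi Suc phi_E_power k.E_nonneg by (intro mult_mono) auto
  also have "\<dots> = \<phi> E ^ ((3 ^ Suc k - 1) div 2) * E"
    unfolding half_power3(2) by (simp only: power_add mult_ac)
  finally have le: "E_fun p f (x (Suc k)) \<le> \<phi> E ^ ((3 ^ Suc k - 1) div 2) * E" .
  also have "\<dots> \<le> E" using E_nonneg phi_E_power by (intro mult_left_le_one_le) auto
  finally have "valid (E_fun p f (x (Suc k)))"
    using p_norm_nonneg by (intro valid_mono[OF valid_E]) (auto simp: E_fun_def)
  then have "ehrlich_step n q f p (x (Suc k))"
    using k.new_distinct deg dim p_ge_1 conjugate
    by unfold_locales (auto simp: ehrlich_iter_Suc)
  then show ?case using le by blast
qed

lemma step: "ehrlich_step n q f p (x k)"
  and E_le_power: "E_fun p f (x k) \<le> \<phi> E ^ ((3 ^ k - 1) div 2) * E"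
  using step_and_E_le by auto

lemma E_iter_nonneg: "0 \<le> E_fun p f (x k)"
  by (simp add: E_fun_def p_norm_nonneg)

lemma E_scaled_le: "\<phi> E ^ m * E \<le> E" "0 \<le> \<phi> E ^ m * E"
  using E_nonneg phi_E_power by (auto intro: mult_left_le_one_le)

lemma E_le: "E_fun p f (x k) \<le> E"
  using E_le_power E_scaled_le(1) by (rule order_trans)

lemma iteration: "ehrlich_iteration n q f p (x k)"
proof -
  interpret k: ehrlich_step n q f p "x k" by (rule step)
  show ?thesis
    by unfold_locales (rule order_trans[OF phi_mono[OF valid_E E_iter_nonneg E_le] phi_le_1])
qed

lemma beta_iter_le: "\<beta> (E_fun p f (x k)) \<le> \<psi> E * \<phi> E ^ 3 ^ k"
proof -
  let ?m = "(3 ^ k - 1) div 2 :: nat"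
  have "\<beta> (E_fun p f (x k)) \<le> \<beta> (\<phi> E ^ ?m * E)"
    by (intro beta_mono valid_mono[OF valid_E] E_scaled_le E_le_power E_iter_nonneg)
  also have "\<dots> \<le> (\<phi> E ^ ?m)\<^sup>2 * \<beta> E"
    using phi_E_power by (intro beta_scale valid_E)
  also have "\<dots> = \<psi> E * \<phi> E ^ 3 ^ k"
    by (simp only: beta_eq[OF valid_E] mult_ac flip: power_half_power3[of _ k])
  finally show ?thesis .
qed

lemma beta_E: "0 \<le> \<beta> E" "\<beta> E < 1"
  using beta_nonneg[OF valid_E] beta_less_1[OF valid_E phi_le_1] by auto

lemma W_iter_le:
  "abs_val (weierstrass f (x k) $ i) \<le> \<psi> E ^ k * \<phi> E ^ ((3 ^ k - 1) div 2) * abs_val (W $ i)"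
proof (induction k)
  case (Suc k)
  interpret k: ehrlich_step n q f p "x k" by (rule step)
  let ?m = "(3 ^ k - 1) div 2 :: nat"
  have "abs_val (weierstrass f (x (Suc k)) $ i) \<le> \<beta> k.E * abs_val (k.W $ i)"
    unfolding ehrlich_iter_Suc by (rule k.new_W_le)
  also have "\<dots> \<le> \<psi> E * \<phi> E ^ 3 ^ k * (\<psi> E ^ k * \<phi> E ^ ?m * abs_val (W $ i))"
    using psi_E phi_E_power by (intro mult_mono beta_iter_le Suc.IH abs_val_nonneg) auto
  also have "\<dots> = \<psi> E ^ Suc k * \<phi> E ^ ((3 ^ Suc k - 1) div 2) * abs_val (W $ i)"
    unfolding half_power3(2) by (simp only: power_add power_Suc mult_ac)
  finally show ?case .
qed simp

text \<open>Geometric decay with a ratio below 1 even if \<open>\<phi> E = 1\<close>. This bound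
  drives convergence, while \<open>W_iter_le\<close> serves the a priori estimate.\<close>

lemma W_iter_le_beta: "abs_val (weierstrass f (x k) $ i) \<le> \<beta> E ^ k * abs_val (W $ i)"
proof (induction k)
  case (Suc k)
  interpret k: ehrlich_step n q f p "x k" by (rule step)
  have "abs_val (weierstrass f (x (Suc k)) $ i) \<le> \<beta> k.E * abs_val (k.W $ i)"
    unfolding ehrlich_iter_Suc by (rule k.new_W_le)
  also have "\<dots> \<le> \<beta> E * (\<beta> E ^ k * abs_val (W $ i))"
    using beta_E by (intro mult_mono beta_mono valid_E E_le E_iter_nonneg Suc.IH abs_val_nonneg) auto
  finally show ?case by simp
qed simp

section \<open>Convergence to a root vector and inclusion in the ball\<close>

abbreviation "radius \<equiv> \<gamma> E / (1 - \<beta> E)"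

lemma radius_nonneg: "0 \<le> radius"
  using gamma_ge_1[OF valid_E] beta_E by simp

text \<open>Telescoping: the displacements are dominated by a geometric series with ratio
  \<open>\<beta> E\<close>, whose sum is the radius.\<close>

lemma iter_dist_le: "abs_val (x k $ i - x0 $ i) \<le> radius * abs_val (W $ i)"
proof -
  have "abs_val (x k $ i - x0 $ i) \<le> \<gamma> E * abs_val (W $ i) * (\<Sum>m<k. \<beta> E ^ m)"
  proof (induction k)
    case (Suc k)
    interpret k: ehrlich_step n q f p "x k" by (rule step)
    have "abs_val (x (Suc k) $ i - x k $ i) \<le> \<gamma> k.E * abs_val (k.W $ i)"
      unfolding ehrlich_iter_Suc by (rule k.displacement_le)
    also have "\<dots> \<le> \<gamma> E * (\<beta> E ^ k * abs_val (W $ i))"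
      using gamma_ge_1[OF valid_E]
      by (intro mult_mono gamma_mono valid_E E_iter_nonneg E_le W_iter_le_beta abs_val_nonneg) auto
    finally show ?case
      using Suc abs_val_triangle[of "x (Suc k) $ i - x k $ i" "x k $ i - x0 $ i"]
      by (simp add: algebra_simps)
  qed simp
  also have "\<dots> \<le> \<gamma> E * abs_val (W $ i) * (1 / (1 - \<beta> E))"
    using gamma_ge_1[OF valid_E] beta_E sum_le_suminf[of "\<lambda>m. \<beta> E ^ m" "{..<k}"]
    by (intro mult_left_mono) (auto simp: suminf_geometric summable_geometric abs_val_nonneg)
  finally show ?thesis by simp
qed

lemma radius_iter_le: "\<gamma> (E_fun p f (x k)) / (1 - \<beta> (E_fun p f (x k))) \<le> radius"
  using gamma_ge_1[OF valid_E] beta_E beta_mono[OF valid_E E_iter_nonneg E_le, of k]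
  by (intro frac_le gamma_mono valid_E E_iter_nonneg E_le) auto

text \<open>\<open>iter_dist_le\<close> for the iteration restarted at \<open>x k\<close>. The bound
  is uniform in \<open>j\<close>, which gives the Cauchy property.\<close>

lemma iter_diff_le: "abs_val (x (k + j) $ i - x k $ i) \<le> radius * \<beta> E ^ k * abs_val (W $ i)"
proof -
  interpret k: ehrlich_iteration n q f p "x k" by (rule iteration)
  have "abs_val (x (k + j) $ i - x k $ i) \<le> k.radius * abs_val (k.W $ i)"
    using k.iter_dist_le[of j i] by (simp only: ehrlich_iter_add)
  also have "\<dots> \<le> radius * (\<beta> E ^ k * abs_val (W $ i))"
    by (intro mult_mono radius_iter_le W_iter_le_beta radius_nonneg abs_val_nonneg)
  finally show ?thesis by (simp only: mult.assoc)
qed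

lemma tendsto_beta_power: "(\<lambda>k. c * \<beta> E ^ k) \<longlonglongrightarrow> 0"
  using beta_E by (auto intro!: tendsto_mult_right_zero LIMSEQ_realpow_zero)

lemma component_convergent: "convergent (\<lambda>k. x k $ i)"
proof (rule Cauchy_convergent, unfold Cauchy_altdef, intro allI impI)
  fix \<epsilon> :: real assume "0 < \<epsilon>"
  then have "\<forall>\<^sub>F k in sequentially. radius * abs_val (W $ i) * \<beta> E ^ k < \<epsilon>"
    using order_tendstoD(2)[OF tendsto_beta_power] by blast
  then obtain M where M: "\<And>k. M \<le> k \<Longrightarrow> radius * abs_val (W $ i) * \<beta> E ^ k < \<epsilon>"
    by (auto simp: eventually_sequentially)
  have "dist (x k $ i) (x l $ i) < \<epsilon>" if "M \<le> k" "k < l" for k l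
    using iter_diff_le[of k "l - k" i] M[OF that(1)] that(2)
    by (simp add: dist_abs_val abs_val_minus_commute[of "x k $ i"] mult_ac)
  then show "\<exists>M. \<forall>k\<ge>M. \<forall>l>k. dist (x k $ i) (x l $ i) < \<epsilon>" by blast
qed

lemma convergent: obtains \<xi> where "x \<longlonglongrightarrow> \<xi>"
proof
  show "x \<longlonglongrightarrow> (\<chi> i. lim (\<lambda>k. x k $ i))"
    by (rule vec_tendstoI) (use component_convergent in \<open>simp add: convergent_LIMSEQ_iff\<close>)
qed

lemma iter_distinct: "x k \<in> distinct_vecs"
  using ehrlich_step.distinct[OF step] .

lemma limit_root_vector:
  assumes "x \<longlonglongrightarrow> \<xi>"
  shows "root_vector f \<xi>"
proof (rule root_vector_limit[OF deg_card iter_distinct assms])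
  show "(\<lambda>k. weierstrass f (x k) $ i) \<longlonglongrightarrow> 0" for i
    unfolding tendsto_abs_val_iff
  proof (rule tendsto_sandwich[OF _ _ tendsto_const])
    show "(\<lambda>k. abs_val (W $ i) * \<beta> E ^ k) \<longlonglongrightarrow> 0" by (rule tendsto_beta_power)
  qed (use W_iter_le_beta in \<open>simp_all add: abs_val_nonneg mult.commute\<close>)
qed

lemma limit_dist_le:
  assumes "x \<longlonglongrightarrow> \<xi>"
  shows "abs_val (x0 $ i - \<xi> $ i) \<le> radius * abs_val (W $ i)"
proof -
  have "(\<lambda>k. dist (x k $ i) (x0 $ i)) \<longlonglongrightarrow> dist (\<xi> $ i) (x0 $ i)"
    by (intro tendsto_dist tendsto_const tendsto_vec_nth assms)
  then have "dist (\<xi> $ i) (x0 $ i) \<le> radius * abs_val (W $ i)"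
    by (rule LIMSEQ_le_const2) (use iter_dist_le in \<open>simp add: dist_abs_val\<close>)
  then show ?thesis by (simp add: dist_abs_val abs_val_minus_commute)
qed

section \<open>Disjoint inclusion disks and simple zeros\<close>

lemma disks_disjoint:
  assumes "\<phi> E < 1" "i \<noteq> j"
  shows "cball (x0 $ i) (radius * abs_val (W $ i)) \<inter> cball (x0 $ j) (radius * abs_val (W $ j)) = {}"
proof -
  let ?D = "abs_val (x0 $ i - x0 $ j)"
  have D: "0 < ?D" using distinct assms(2) by (auto simp: distinct_vecs_iff abs_val_pos_iff)
  have "abs_val (W $ i) + abs_val (W $ j) \<le> (abs_val (W $ i) / d $ i + abs_val (W $ j) / d $ j) * ?D"
    using W_le[of j i] W_le[of i j] assms by (simp add: distrib_right abs_val_minus_commute)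
  also have "\<dots> \<le> b * E * ?D"
    using pair_quot_le[OF assms(2)] by (intro mult_right_mono abs_val_nonneg)
  finally have "radius * (abs_val (W $ i) + abs_val (W $ j)) \<le> radius * (b * E * ?D)"
    by (intro mult_left_mono radius_nonneg)
  \<comment> \<open>The condition \<open>\<phi> E < 1\<close> enters here as
    \<open>\<beta> E < \<psi> E\<close>: it makes the sum of the two radii smaller than the distance
    of the centers.\<close>
  also have "\<dots> = (1 - \<psi> E) / (1 - \<beta> E) * ?D"
    using one_minus_psi[OF valid_E] by simp
  also have "\<dots> < 1 * ?D"
  proof (intro mult_strict_right_mono D)
    have "\<beta> E < \<psi> E" using assms(1) psi_E by (simp add: beta_eq[OF valid_E])
    then show "(1 - \<psi> E) / (1 - \<beta> E) < 1" using beta_E by simp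
  qed
  finally have less: "radius * abs_val (W $ i) + radius * abs_val (W $ j) < dist (x0 $ i) (x0 $ j)"
    by (simp add: dist_abs_val distrib_left)
  show ?thesis
  proof (rule equals0I)
    fix z assume "z \<in> cball (x0 $ i) (radius * abs_val (W $ i)) \<inter> cball (x0 $ j) (radius * abs_val (W $ j))"
    then show False using less dist_triangle2[of "x0 $ i" "x0 $ j" z] by simp
  qed
qed

lemma limit_distinct:
  assumes "x \<longlonglongrightarrow> \<xi>" "\<phi> E < 1"
  shows "\<xi> \<in> distinct_vecs"
  unfolding distinct_vecs_iff
proof (intro allI impI notI)
  fix i j :: 'n assume "i \<noteq> j" and eq: "\<xi> $ i = \<xi> $ j"
  have in_disk: "\<xi> $ i \<in> cball (x0 $ i) (radius * abs_val (W $ i))" for i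
    using limit_dist_le[OF assms(1), of i] by (simp add: dist_abs_val)
  show False
    using disks_disjoint[OF assms(2) \<open>i \<noteq> j\<close>] in_disk[of i] in_disk[of j] unfolding eq by blast
qed

text \<open>The zeros are exactly the components of \<open>\<xi>\<close>, and component
  \<open>j\<close> lies in disk \<open>j\<close>; disjointness leaves one zero for each
  disk.\<close>

lemma disk_unique_zero:
  assumes "x \<longlonglongrightarrow> \<xi>" "\<phi> E < 1"
  shows "\<exists>!z. z \<in> cball (x0 $ i) (radius * abs_val (W $ i)) \<and> poly f z = 0"
proof -
  have in_disk: "\<xi> $ j \<in> cball (x0 $ j) (radius * abs_val (W $ j))" for j
    using limit_dist_le[OF assms(1), of j] by (simp add: dist_abs_val)
  have zeros: "{z. poly f z = 0} = range (($) \<xi>)"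
    by (rule simple_zeros_root_vector[OF deg_card limit_root_vector limit_distinct]) (use assms in auto)
  show ?thesis
  proof (intro ex1I[of _ "\<xi> $ i"] conjI in_disk)
    show "poly f (\<xi> $ i) = 0" using zeros by blast
    fix z assume z: "z \<in> cball (x0 $ i) (radius * abs_val (W $ i)) \<and> poly f z = 0"
    then obtain j where "z = \<xi> $ j" using zeros by blast
    then show "z = \<xi> $ i" using z in_disk[of j] disks_disjoint[OF assms(2), of i j] by (cases "i = j") auto
  qed
qed

section \<open>Error estimates for the iterates\<close>

lemma iter_limit_dist_le:
  assumes "x \<longlonglongrightarrow> \<xi>"
  shows "abs_val (x k $ i - \<xi> $ i) \<le>
    \<gamma> (E_fun p f (x k)) / (1 - \<beta> (E_fun p f (x k))) * abs_val (weierstrass f (x k) $ i)"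
proof -
  interpret k: ehrlich_iteration n q f p "x k" by (rule iteration)
  have "ehrlich_iter f (x k) \<longlonglongrightarrow> \<xi>"
    using LIMSEQ_ignore_initial_segment[OF assms, of k] by (simp only: ehrlich_iter_shift)
  then show ?thesis by (rule k.limit_dist_le)
qed

text \<open>Every quantity at iterate \<open>k\<close> in \<open>iter_limit_dist_le\<close> is
  replaced by its bound in terms of the starting vector, using that \<open>\<gamma>\<close> is
  monotone.\<close>

lemma a_priori_bound:
  assumes "x \<longlonglongrightarrow> \<xi>"
  shows "abs_val (x k $ i - \<xi> $ i) \<le> \<gamma> (E * \<phi> E ^ ((3 ^ k - 1) div 2)) *
    (\<psi> E ^ k * \<phi> E ^ ((3 ^ k - 1) div 2) / (1 - \<psi> E * \<phi> E ^ 3 ^ k)) * abs_val (W $ i)"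
proof -
  let ?m = "(3 ^ k - 1) div 2 :: nat"
  interpret k: ehrlich_iteration n q f p "x k" by (rule iteration)
  \<comment> \<open>For \<open>E = 0\<close> the value \<open>\<psi> E\<close> is 1, but then
    \<open>\<phi> E\<close> is 0 and its exponent is positive.\<close>
  have less: "\<psi> E * \<phi> E ^ 3 ^ k < 1"
  proof (cases "E = 0")
    case False
    then have "\<psi> E < 1" using E_nonneg by (intro psi_less_1 valid_E) auto
    moreover have "\<psi> E * \<phi> E ^ 3 ^ k \<le> \<psi> E * 1"
      using psi_E phi_E_power by (intro mult_left_mono) auto
    ultimately show ?thesis by simp
  qed (simp add: power_0_left)
  have "k.radius \<le> \<gamma> (E * \<phi> E ^ ?m) / (1 - \<psi> E * \<phi> E ^ 3 ^ k)"
    using less beta_iter_le[of k] gamma_ge_1[OF valid_mono[OF valid_E E_scaled_le(2) E_scaled_le(1)], of ?m]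
      gamma_mono[OF valid_mono[OF valid_E E_scaled_le(2) E_scaled_le(1)] E_iter_nonneg E_le_power, of k]
    by (intro frac_le) (auto simp: mult.commute)
  then have "k.radius * abs_val (k.W $ i) \<le> \<gamma> (E * \<phi> E ^ ?m) / (1 - \<psi> E * \<phi> E ^ 3 ^ k) *
      (\<psi> E ^ k * \<phi> E ^ ?m * abs_val (W $ i))"
    using k.radius_nonneg by (intro mult_mono W_iter_le abs_val_nonneg) auto
  then show ?thesis using iter_limit_dist_le[OF assms, of k i] by simp
qed

text \<open>The estimate at the iterate \<open>x (Suc 0)\<close>, with its correction and its value
  of \<open>\<beta>\<close> traced back to \<open>x0\<close>. Restarting at \<open>x k\<close> gives
  the general case.\<close>

lemma next_iter_bound:
  assumes "x \<longlonglongrightarrow> \<xi>"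
  shows "abs_val (x (Suc 0) $ i - \<xi> $ i) \<le>
    \<psi> E * \<phi> E / (1 - \<psi> E * \<phi> E ^ 3) * \<gamma> (E_fun p f (x (Suc 0))) * abs_val (W $ i)"
proof -
  interpret s: ehrlich_iteration n q f p "x (Suc 0)" by (rule iteration)
  have "\<psi> E * \<phi> E ^ 3 \<le> \<psi> E * \<phi> E ^ 1"
    using psi_E phi_E_nonneg phi_le_1 by (intro mult_left_mono power_decreasing) auto
  then have less: "\<psi> E * \<phi> E ^ 3 < 1" using beta_E by (simp add: beta_eq[OF valid_E])
  have "s.radius * abs_val (s.W $ i) \<le> \<gamma> s.E / (1 - \<psi> E * \<phi> E ^ 3) * (\<psi> E * \<phi> E * abs_val (W $ i))"
  proof (intro mult_mono abs_val_nonneg)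
    show "abs_val (s.W $ i) \<le> \<psi> E * \<phi> E * abs_val (W $ i)"
      using new_W_le[of i] by (simp add: ehrlich_iter_Suc beta_eq[OF valid_E])
    show "s.radius \<le> \<gamma> s.E / (1 - \<psi> E * \<phi> E ^ 3)"
      using less beta_iter_le[of "Suc 0"] gamma_ge_1[OF s.valid_E] by (intro frac_le) auto
    show "0 \<le> \<gamma> s.E / (1 - \<psi> E * \<phi> E ^ 3)"
      using less gamma_ge_1[OF s.valid_E] by simp
  qed
  then show ?thesis using iter_limit_dist_le[OF assms, of "Suc 0" i] by (simp add: mult_ac)
qed

section \<open>Cubic order of convergence\<close>

lemma beta_iter_le_square: "\<beta> (E_fun p f (x k)) \<le> \<beta> E / E\<^sup>2 * (E_fun p f (x k))\<^sup>2"
proof (cases "E = 0")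
  case True
  then have "E_fun p f (x k) = 0" using E_le[of k] E_iter_nonneg[of k] by simp
  then show ?thesis using valid_E True by (simp add: beta_eq)
next
  case False
  then show ?thesis
    using beta_scale[OF valid_E, of "E_fun p f (x k) / E"] E_le[of k] E_iter_nonneg[of k] E_nonneg
    by (simp add: power_divide mult.commute)
qed

text \<open>The product in \<open>weierstrass_root_vector\<close> tends to 1, so it is eventually
  below 2; any constant above 1 would serve.\<close>

lemma eventually_W_le:
  assumes lim: "x \<longlonglongrightarrow> \<xi>" and phi: "\<phi> E < 1"
  shows "\<forall>\<^sub>F k in sequentially. abs_val (weierstrass f (x k) $ i) \<le> 2 * abs_val (x k $ i - \<xi> $ i)"
proof -
  have \<xi>: "\<xi> \<in> distinct_vecs" by (rule limit_distinct[OF lim phi])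
  have diff: "(\<lambda>k. abs_val (u k - v k)) \<longlonglongrightarrow> abs_val (u' - v')"
    if "u \<longlonglongrightarrow> u'" "v \<longlonglongrightarrow> v'" for u v :: "nat \<Rightarrow> 'a" and u' v'
    using tendsto_dist[OF that] by (simp add: dist_abs_val)
  have "(\<lambda>k. \<Prod>j\<in>UNIV - {i}. abs_val (x k $ i - \<xi> $ j) / abs_val (x k $ i - x k $ j))
      \<longlonglongrightarrow> (\<Prod>j\<in>UNIV - {i}. abs_val (\<xi> $ i - \<xi> $ j) / abs_val (\<xi> $ i - \<xi> $ j))"
    using \<xi> by (intro tendsto_prod tendsto_divide diff tendsto_vec_nth[OF lim] tendsto_const)
      (auto simp: abs_val_eq_0_iff distinct_vecs_iff)
  also have "(\<Prod>j\<in>UNIV - {i}. abs_val (\<xi> $ i - \<xi> $ j) / abs_val (\<xi> $ i - \<xi> $ j)) = 1"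
    using \<xi> by (intro prod.neutral) (auto simp: abs_val_eq_0_iff distinct_vecs_iff)
  finally have "\<forall>\<^sub>F k in sequentially.
      (\<Prod>j\<in>UNIV - {i}. abs_val (x k $ i - \<xi> $ j) / abs_val (x k $ i - x k $ j)) < 2"
    by (rule order_tendstoD) simp
  then show ?thesis
  proof eventually_elim
    case (elim k)
    have "abs_val (weierstrass f (x k) $ i) = abs_val (x k $ i - \<xi> $ i) *
        (\<Prod>j\<in>UNIV - {i}. abs_val (x k $ i - \<xi> $ j) / abs_val (x k $ i - x k $ j))"
      by (simp add: weierstrass_root_vector[OF deg_card limit_root_vector[OF lim]]
          abs_val_mult abs_val_prod abs_val_divide)
    also have "\<dots> \<le> abs_val (x k $ i - \<xi> $ i) * 2"
      using elim by (intro mult_left_mono abs_val_nonneg) auto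
    finally show ?case by (simp add: mult.commute)
  qed
qed

lemma eventually_separation_ge:
  assumes lim: "x \<longlonglongrightarrow> \<xi>"
  shows "\<forall>\<^sub>F k in sequentially. separation \<xi> $ i / 2 \<le> separation (x k) $ i"
proof (cases "0 < separation \<xi> $ i")
  case True
  have "\<forall>\<^sub>F k in sequentially. \<forall>j\<in>UNIV - {i}. separation \<xi> $ i / 2 < dist (x k $ i) (x k $ j)"
  proof (intro eventually_ball_finite ballI)
    fix j assume "j \<in> UNIV - {i}"
    then have "separation \<xi> $ i / 2 < dist (\<xi> $ i) (\<xi> $ j)"
      using separation_le[of j i \<xi>] True by (simp add: dist_abs_val)
    then show "\<forall>\<^sub>F k in sequentially. separation \<xi> $ i / 2 < dist (x k $ i) (x k $ j)"
      by (rule order_tendstoD(1)[OF tendsto_dist[OF tendsto_vec_nth[OF lim] tendsto_vec_nth[OF lim]]])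
  qed simp
  then show ?thesis
  proof eventually_elim
    case (elim k)
    then show ?case using n_ge_2 dim
      by (intro separation_greatest) (auto simp: dist_abs_val less_imp_le)
  qed
next
  case False
  moreover have "0 < separation (x k) $ i" for k
    using separation_pos[OF _ iter_distinct] n_ge_2 dim by simp
  ultimately show ?thesis by (intro always_eventually allI) (smt (verit) field_sum_of_halves)
qed

text \<open>If \<open>\<Delta>\<close> is the error at iterate \<open>k\<close>, then the
  corrections and hence \<open>k.E\<close> are of order \<open>\<Delta>\<close>, so
  \<open>\<beta> k.E\<close> is of order \<open>\<Delta>\<^sup>2\<close>. The next corrections are
  thus of order \<open>\<Delta> ^ 3\<close>, and they control the next error.\<close>

lemma cubic_convergence:
  assumes lim: "x \<longlonglongrightarrow> \<xi>" and phi: "\<phi> E < 1"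
  shows "converges_with_order 3 x \<xi>"
proof -
  define \<delta> where "\<delta> = Min (range (\<lambda>i. separation \<xi> $ i))"
  have "0 < separation \<xi> $ i" for i
    using separation_pos[OF _ limit_distinct[OF lim phi]] n_ge_2 dim by simp
  then have \<delta>: "0 < \<delta>" "\<And>i. \<delta> \<le> separation \<xi> $ i" by (simp_all add: \<delta>_def)
  define N where "N = p_norm p (\<chi> i::'n. 1)"
  have N: "0 \<le> N" by (simp add: N_def p_norm_nonneg)
  \<comment> \<open>The 2 comes from \<open>eventually_W_le\<close>, \<open>4 / \<delta>\<close> is
    this 2 divided by the eventual lower bound \<open>\<delta> / 2\<close> of the separations, and
    \<open>N\<close> passes from components to the \<open>p\<close>-norm.\<close>
  define C where "C = radius * (\<beta> E / E\<^sup>2 * (N * (4 / \<delta>))\<^sup>2 * 2)"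
  have "\<forall>\<^sub>F k in sequentially. \<forall>i\<in>UNIV. abs_val (weierstrass f (x k) $ i) \<le> 2 * abs_val (x k $ i - \<xi> $ i)
      \<and> separation \<xi> $ i / 2 \<le> separation (x k) $ i"
    by (intro eventually_ball_finite ballI eventually_conj eventually_W_le eventually_separation_ge lim phi) simp
  then have "\<forall>\<^sub>F k in sequentially. dist (x (Suc k)) \<xi> \<le> real n * C * dist (x k) \<xi> ^ 3"
  proof eventually_elim
    case (elim k)
    define \<Delta> where "\<Delta> = dist (x k) \<xi>"
    interpret k: ehrlich_step n q f p "x k" by (rule step)
    have W: "abs_val (k.W $ i) \<le> 2 * \<Delta>" for i
      using elim dist_vec_nth_le[of "x k" i \<xi>] unfolding \<Delta>_def by (auto simp: dist_abs_val intro: order_trans)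
    have "abs_val (k.W $ i) / k.d $ i \<le> 4 / \<delta> * \<Delta>" for i
    proof -
      have "\<delta> / 2 \<le> k.d $ i" using elim \<delta>(2)[of i] by (auto intro: order_trans[rotated])
      then have "abs_val (k.W $ i) / k.d $ i \<le> 2 * \<Delta> / (\<delta> / 2)"
        using W[of i] \<delta>(1) by (intro frac_le) (auto simp: \<Delta>_def)
      then show ?thesis by simp
    qed
    then have "k.E \<le> N * (4 / \<delta> * \<Delta>)"
      unfolding E_fun_def N_def using k.d_pos
      by (intro p_norm_le_bound[OF p_ge_1]) (auto simp: vec_quot_def abs_of_pos abs_of_nonneg abs_val_nonneg)
    then have "k.E\<^sup>2 \<le> (N * (4 / \<delta> * \<Delta>))\<^sup>2" by (intro power_mono k.E_nonneg)
    then have "\<beta> k.E \<le> \<beta> E / E\<^sup>2 * (N * (4 / \<delta> * \<Delta>))\<^sup>2"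
      using beta_E by (intro order_trans[OF beta_iter_le_square] mult_left_mono) auto
    then have "\<beta> k.E * abs_val (k.W $ i) \<le> \<beta> E / E\<^sup>2 * (N * (4 / \<delta> * \<Delta>))\<^sup>2 * (2 * \<Delta>)" for i
      using beta_E by (intro mult_mono W abs_val_nonneg) auto
    then have "abs_val (weierstrass f (x (Suc k)) $ i) \<le> \<beta> E / E\<^sup>2 * (N * (4 / \<delta> * \<Delta>))\<^sup>2 * (2 * \<Delta>)" for i
      using k.new_W_le[of i] unfolding ehrlich_iter_Suc by (rule order_trans[rotated])
    then have "abs_val (x (Suc k) $ i - \<xi> $ i)
        \<le> radius * (\<beta> E / E\<^sup>2 * (N * (4 / \<delta> * \<Delta>))\<^sup>2 * (2 * \<Delta>))" for i
      by (intro order_trans[OF iter_limit_dist_le[OF lim]] mult_mono radius_iter_le radius_nonneg abs_val_nonneg)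
    moreover have "radius * (\<beta> E / E\<^sup>2 * (N * (4 / \<delta> * \<Delta>))\<^sup>2 * (2 * \<Delta>)) = C * \<Delta> ^ 3"
      by (simp add: C_def power_mult_distrib power_divide power2_eq_square power3_eq_cube)
    ultimately have "dist (x (Suc k) $ i) (\<xi> $ i) \<le> C * \<Delta> ^ 3" for i
      by (simp add: dist_abs_val)
    then have "(\<Sum>i\<in>UNIV. dist (x (Suc k) $ i) (\<xi> $ i)) \<le> real n * (C * \<Delta> ^ 3)"
      using sum_bounded_above[of UNIV "\<lambda>i. dist (x (Suc k) $ i) (\<xi> $ i)" "C * \<Delta> ^ 3"] dim by simp
    \<comment> \<open>The distance of vectors is the Euclidean combination of the component
      distances and is at most their sum; this accounts for the factor
      \<open>real n\<close>.\<close>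
    moreover have "dist (x (Suc k)) \<xi> \<le> (\<Sum>i\<in>UNIV. dist (x (Suc k) $ i) (\<xi> $ i))"
      unfolding dist_vec_def by (rule L2_set_le_sum) simp
    ultimately show ?case by (simp add: \<Delta>_def mult.assoc)
  qed
  then show ?thesis using lim by (auto simp: converges_with_order_def)
qed

end

section \<open>Assembly of claims (i) to (v)\<close>

theorem theorem3p4:
  fixes f :: "'a::complete_normed_field poly"
    and n :: nat
    and p q :: ereal
    and x0 :: "'a ^ 'n"
    and \<gamma> \<psi> \<beta> \<phi> :: "real \<Rightarrow> real"
    and E :: "'a ^ 'n \<Rightarrow> real"
    and x :: "nat \<Rightarrow> 'a ^ 'n"
    and lam \<theta> A :: "nat \<Rightarrow> real"
  defines "\<gamma> \<equiv> gamma_fun n q" and "\<psi> \<equiv> psi_fun n q"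
    and "\<beta> \<equiv> beta_fun n q" and "\<phi> \<equiv> phi_fun n q"
    and "E \<equiv> E_fun p f"
    and "x \<equiv> ehrlich_iter f x0"
    and "lam \<equiv> \<lambda>k. \<phi> (E (x k))"
    and "\<theta> \<equiv> \<lambda>k. \<psi> (E (x k))"
    and "A \<equiv> \<lambda>k. \<gamma> (E x0 * lam 0 ^ ((3 ^ k - 1) div 2))"
  assumes deg: "degree f = n" and n_ge_2: "n \<ge> 2" and dim: "CARD('n) = n"
    and p_ge_1: "1 \<le> p" and q_ge_1: "1 \<le> q" and conjugate: "1 / p + 1 / q = 1"
    and x0_distinct: "x0 \<in> distinct_vecs"
    and E_x0: "E x0 < 1 / (coeff_a n q + coeff_b q)" and phi_x0: "\<phi> (E x0) \<le> 1"
  shows "\<exists>\<xi>.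
    \<comment> \<open>(i)\<close>
    (\<forall>k. x k \<in> ehrlich_domain f) \<and>
    (\<forall>k. x k \<in> cone_cball x0
       ((\<gamma> (E x0) / (1 - \<beta> (E x0))) *\<^sub>R cone_norm (weierstrass f x0))) \<and>
    root_vector f \<xi> \<and>
    x \<longlonglongrightarrow> \<xi> \<and>
    (\<phi> (E x0) < 1 \<longrightarrow> converges_with_order 3 x \<xi>) \<and>
    \<comment> \<open>(ii)\<close>
    (\<forall>k. cone_norm (x k - \<xi>) \<le>
       (A k * (\<theta> 0 ^ k * lam 0 ^ ((3 ^ k - 1) div 2) / (1 - \<theta> 0 * lam 0 ^ (3 ^ k))))
         *\<^sub>R cone_norm (weierstrass f x0)) \<and>
    \<comment> \<open>(iii)\<close>
    (\<forall>k. cone_norm (x k - \<xi>) \<le>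
       (\<gamma> (E (x k)) / (1 - \<beta> (E (x k)))) *\<^sub>R cone_norm (weierstrass f (x k))) \<and>
    \<comment> \<open>(iv)\<close>
    (\<forall>k. cone_norm (x (Suc k) - \<xi>) \<le>
       (\<theta> k * lam k / (1 - \<theta> k * lam k ^ 3) * \<gamma> (E (x (Suc k))))
         *\<^sub>R cone_norm (weierstrass f (x k))) \<and>
    \<comment> \<open>(v)\<close>
    (\<phi> (E x0) < 1 \<longrightarrow>
       card {z. poly f z = 0 \<and> order z f = 1} = n \<and>
       (\<forall>k. let D = (\<lambda>i. cball (x k $ i)
                   (\<gamma> (E (x k)) / (1 - \<beta> (E (x k))) * abs_val (weierstrass f (x k) $ i)))
            in disjoint_family D \<and> (\<forall>i. \<exists>!z. z \<in> D i \<and> poly f z = 0)))"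
proof -
  interpret degree_exponent n q
    using n_ge_2 q_ge_1 by unfold_locales
  interpret ehrlich_iteration n q f p x0
    using assms p_norm_nonneg[of p]
    by unfold_locales (auto simp: valid_iff E_fun_def)
  obtain \<xi> where lim: "ehrlich_iter f x0 \<longlonglongrightarrow> \<xi>" by (rule convergent)
  have lim_k: "ehrlich_iter f (ehrlich_iter f x0 k) \<longlonglongrightarrow> \<xi>" for k
    using LIMSEQ_ignore_initial_segment[OF lim, of k] by (simp only: ehrlich_iter_shift)
  have phi_k: "phi_fun n q (E_fun p f (ehrlich_iter f x0 k)) < 1" if "phi_fun n q (E_fun p f x0) < 1" for k
    using phi_mono[OF valid_E E_iter_nonneg E_le, of k] that by simp
  show ?thesis
    unfolding A_def lam_def \<theta>_def x_def E_def \<gamma>_def \<psi>_def \<beta>_def \<phi>_def Let_def ehrlich_iter_0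
  proof (intro exI[of _ \<xi>] conjI allI impI)
    fix k
    \<comment> \<open>Claims (iii), (iv) and the disks of (v) at index \<open>k\<close> are the
      results for a starting vector, read at iterate \<open>k\<close>; \<open>lim_k\<close> and
      \<open>phi_k\<close> carry over the limit and the strict inequality.\<close>
    interpret k: ehrlich_iteration n q f p "ehrlich_iter f x0 k" by (rule iteration)
    show "ehrlich_iter f x0 k \<in> ehrlich_domain f" by (rule k.in_domain)
    show "ehrlich_iter f x0 k \<in> cone_cball x0 (radius *\<^sub>R cone_norm (weierstrass f x0))"
      using iter_dist_le[of k] by (simp add: cone_cball_def less_eq_vec_def cone_norm_def)
    show "cone_norm (ehrlich_iter f x0 k - \<xi>) \<le>
        (gamma_fun n q (E_fun p f x0 * phi_fun n q (E_fun p f x0) ^ ((3 ^ k - 1) div 2)) *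
         (psi_fun n q (E_fun p f x0) ^ k * phi_fun n q (E_fun p f x0) ^ ((3 ^ k - 1) div 2) /
          (1 - psi_fun n q (E_fun p f x0) * phi_fun n q (E_fun p f x0) ^ 3 ^ k))) *\<^sub>R
        cone_norm (weierstrass f x0)"
      using a_priori_bound[OF lim, of k] by (simp add: less_eq_vec_def cone_norm_def)
    show "cone_norm (ehrlich_iter f x0 k - \<xi>) \<le> k.radius *\<^sub>R cone_norm (weierstrass f (ehrlich_iter f x0 k))"
      using k.limit_dist_le[OF lim_k] by (simp add: less_eq_vec_def cone_norm_def)
    show "cone_norm (ehrlich_iter f x0 (Suc k) - \<xi>) \<le>
        (psi_fun n q k.E * phi_fun n q k.E / (1 - psi_fun n q k.E * phi_fun n q k.E ^ 3) *
         gamma_fun n q (E_fun p f (ehrlich_iter f x0 (Suc k)))) *\<^sub>R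
        cone_norm (weierstrass f (ehrlich_iter f x0 k))"
      using k.next_iter_bound[OF lim_k] by (simp add: less_eq_vec_def cone_norm_def ehrlich_iter_Suc)
    assume phi: "phi_fun n q (E_fun p f x0) < 1"
    show "disjoint_family (\<lambda>i. cball (ehrlich_iter f x0 k $ i)
        (k.radius * abs_val (weierstrass f (ehrlich_iter f x0 k) $ i)))"
      unfolding disjoint_family_on_def using k.disks_disjoint[OF phi_k[OF phi]] by blast
    show "\<exists>!z. z \<in> cball (ehrlich_iter f x0 k $ i)
        (k.radius * abs_val (weierstrass f (ehrlich_iter f x0 k) $ i)) \<and> poly f z = 0" for i
      by (rule k.disk_unique_zero[OF lim_k phi_k[OF phi]])
  next
    assume phi: "phi_fun n q (E_fun p f x0) < 1"
    show "converges_with_order 3 (ehrlich_iter f x0) \<xi>"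
      by (rule cubic_convergence[OF lim phi])
    have \<xi>: "\<xi> \<in> distinct_vecs" by (rule limit_distinct[OF lim phi])
    then show "card {z. poly f z = 0 \<and> order z f = 1} = n"
      using simple_zeros_root_vector(2)[OF deg_card limit_root_vector[OF lim] \<xi>] dim
      by (simp add: card_image distinct_vecs_def)
  qed (use lim limit_root_vector in auto)
qed

end
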